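(* Let $0<c<1$ be a real number and let $d$ be a positive integer that is not a perfect square. Let $\mathbb{A}_{c,d}$ be the set of all quadratic irrational numbers $\alpha=(b\pm\sqrt{d})/a$ with $a,b\in\mathbb{Z}_{>0}$ such that $c<(b-\sqrt d)/a<(b+\sqrt d)/a<1$. Let $\sigma$ be a fixed real number with $1/2<\sigma<1$. Then for any $z_0\in\mathbb{C}$ and $\epsilon>0$ there exists a finite subset $\mathcal{E}_{c,d}=\mathcal{E}_{c,d}(\sigma,z_0,\epsilon)\subset\mathbb{A}_{c,d}$ such that for every $\alpha\in\mathbb{A}_{c,d}\setminus\mathcal{E}_{c,d}$, $$\liminf_{T\to\infty}\frac{1}{T}\,\mathrm{meas}\{t\in[0,T] : |\zeta(\sigma+it,\alpha)-z_0|<\epsilon\}>0.$$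
   Context: $\zeta(s,\alpha)=\sum_{n=0}^\infty (n+\alpha)^{-s}$ (for $\mathrm{Re}\,s>1$) is the Hurwitz zeta-function, extended by analytic continuation to $\mathbb{C}\setminus\{1\}$; $\mathrm{meas}$ is Lebesgue measure on $\mathbb{R}$. *)

theory Defs
  imports
    "HOL-Complex_Analysis.Complex_Analysis"
    "HOL-Computational_Algebra.Nth_Powers"
begin

(* The holomorphic continuation to the complex plane minus 1 exists for 0 < alpha and is unique by
   the identity theorem. The clause f 1 = 0 only fixes the otherwise arbitrary value at the pole,
   so that the description is unique; the values at all other points do not depend on it. *)
definition hurwitz_zeta :: "complex \<Rightarrow> real \<Rightarrow> complex" where
  "hurwitz_zeta s \<alpha> =
     (THE f :: complex \<Rightarrow> complex. f holomorphic_on - {1} \<and>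
        (\<forall>z. Re z > 1 \<longrightarrow> (\<lambda>n. of_real (real n + \<alpha>) powr (- z)) sums f z) \<and>
        f 1 = 0) s"

(* Irrationality of the elements is automatic when d is not a perfect square. *)
definition quad_irrationals :: "real \<Rightarrow> nat \<Rightarrow> real set" where
  "quad_irrationals c d =
     {\<alpha>. \<exists>a b :: int. a > 0 \<and> b > 0 \<and>
        c < (of_int b - sqrt (real d)) / of_int a \<and>
        (of_int b - sqrt (real d)) / of_int a < (of_int b + sqrt (real d)) / of_int a \<and>
        (of_int b + sqrt (real d)) / of_int a < 1 \<and>
        (\<alpha> = (of_int b + sqrt (real d)) / of_int a \<or>
         \<alpha> = (of_int b - sqrt (real d)) / of_int a)}"

end

theory Submission
  imports Defs "HOL-Probability.Probability" "HOL-Real_Asymp.Real_Asymp"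
begin

text \<open>
  Fix \<open>N\<close> so large that suitable phases \<open>\<theta>\<^sub>n\<close> make the sum of \<open>(n + \<alpha>)\<close> to the power \<open>-\<sigma>\<close>
  times \<open>exp(i\<theta>\<^sub>n)\<close> over \<open>n < N\<close> come close to \<open>z\<^sub>0\<close>, and that the tail has small mean square. The times
  \<open>t\<close> at which \<open>(n + \<alpha>)\<close> to the power \<open>-it\<close> is near \<open>exp(i\<theta>\<^sub>n)\<close> for all \<open>n < N\<close> are selected by the
  weight \<open>W = \<bar>P\<bar>\<^sup>2\<close>, where \<open>P\<close> is a product of geometric sums of length \<open>K\<close>; \<open>W\<close> is bounded, so it
  is enough to bound the \<open>W\<close>-weighted mean square of \<open>\<zeta>(\<sigma> + it, \<alpha>) - z\<^sub>0\<close>. Only multiplicative relations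
  between the numbers \<open>n + \<alpha>\<close> with exponents at most \<open>K\<close> disturb the orthogonality of the frequencies
  below a height \<open>M\<close>. Each such relation is a nonzero polynomial equation for \<open>\<alpha>\<close>, so only finitely many
  \<open>\<alpha>\<close> satisfy one of them. The terms beyond \<open>M\<close> are harmless: a frequency has boundedly many near
  neighbours, all of comparable size because \<open>\<alpha> > c\<close>, and the sum of \<open>m\<close> to the power \<open>-2\<sigma>\<close> converges.
\<close>

section \<open>Analytic continuation of the Hurwitz zeta function\<close>

text \<open>For algebraic \<alpha> the numbers \<open>ln (n + \<alpha>)\<close> can be linearly
  dependent over the rationals: \<alpha> = (sqrt 5 - 1)/2 satisfies \<alpha> (1 + \<alpha>) = 1.
  This dictates the order of choices: N, then K, then M are fixed from c, \<sigma>, \<epsilon> and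
  the target value, and the exceptional set from N, K, M, all before \<alpha>; only the phases may
  depend on \<alpha>. Hence every estimate must be uniform in c < \<alpha> < 1. Zeta is replaced by
  its first T^(1+\<delta>) terms. This length is more than T, which makes the truncation error easy,
  but frequencies with m beyond T are then no longer separated at scale 1/T. With window
  T^(\<delta>-1) such a frequency has at most a constant times m^(2\<delta>) neighbours, and a small
  \<delta> keeps the sum of m^(2\<delta>-2\<sigma>) convergent. Times are taken from [T/2, T] only:
  there |s - 1| is comparable to T, and this costs no more than a constant in the density. Upper
  mean squares are majorized by a Gaussian weight because its Fourier transform is positive and
  decays fast.\<close>

lemma holomorphic_on_integral_param:
  fixes f :: "complex \<Rightarrow> real \<Rightarrow> complex"
  assumes U: "open U" and cont: "continuous_on (U \<times> {0..1}) (\<lambda>(z, u). f z u)"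
    and holo: "\<And>u. u \<in> {0..1} \<Longrightarrow> (\<lambda>z. f z u) holomorphic_on U"
  shows "(\<lambda>z. integral {0..1} (f z)) holomorphic_on U"
proof -
  \<comment> \<open>Read as a contour integral over \<open>linepath 0 1\<close>, the parameter
    integral can be exchanged with the triangle integrals of Morera's theorem by
    \<open>contour_integral_swap\<close>.\<close>
  have eq: "contour_integral (linepath 0 1) (\<lambda>w. f z (Re w)) = integral {0..1} (f z)" for z
    unfolding contour_integral_integral
    by (rule Henstock_Kurzweil_Integration.integral_cong) (auto simp: linepath_def)
  have "(\<lambda>z. integral {0..1} (f z)) analytic_on U"
  proof (rule Morera_triangle)
    show "continuous_on U (\<lambda>z. integral {0..1} (f z))"
      using integral_continuous_on_param[of U 0 1 f] cont by simp
    show "open U" by fact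
    fix a b c
    show "convex hull {a, b, c} \<subseteq> U \<longrightarrow>
       contour_integral (linepath a b) (\<lambda>z. integral {0..1} (f z)) +
       contour_integral (linepath b c) (\<lambda>z. integral {0..1} (f z)) +
       contour_integral (linepath c a) (\<lambda>z. integral {0..1} (f z)) = 0"
    proof
      assume hull: "convex hull {a, b, c} \<subseteq> U"
      have swap: "contour_integral (linepath p q) (\<lambda>z. integral {0..1} (f z)) =
          integral {0..1} (\<lambda>u. contour_integral (linepath p q) (\<lambda>z. f z u))"
        and int: "(\<lambda>u. contour_integral (linepath p q) (\<lambda>z. f z u)) integrable_on {0..1}"
        if pq: "closed_segment p q \<subseteq> U" for p q
      proof -
        have c1: "continuous_on (closed_segment p q \<times> closed_segment 0 1) (\<lambda>(z, w). f z (Re w))"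
        proof -
          have "continuous_on (closed_segment p q \<times> closed_segment 0 1)
             ((\<lambda>(z, u). f z u) \<circ> (\<lambda>(z, w). (z, Re w)))"
          proof (rule continuous_on_compose)
            show "continuous_on (closed_segment p q \<times> closed_segment 0 1) (\<lambda>(z, w). (z, Re w))"
              by (auto simp: case_prod_unfold intro!: continuous_intros)
            show "continuous_on ((\<lambda>(z, w). (z, Re w)) ` (closed_segment p q \<times> closed_segment 0 1)) (\<lambda>(z, u). f z u)"
              by (rule continuous_on_subset[OF cont]) (use pq in \<open>auto simp: closed_segment_def\<close>)
          qed
          thus ?thesis by (simp add: o_def case_prod_unfold)
        qed
        have "contour_integral (linepath p q) (\<lambda>z. contour_integral (linepath 0 1) (\<lambda>w. f z (Re w))) =
              contour_integral (linepath 0 1) (\<lambda>w. contour_integral (linepath p q) (\<lambda>z. f z (Re w)))"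
          by (rule contour_integral_swap) (use c1 in auto)
        also have "\<dots> = integral {0..1} (\<lambda>u. contour_integral (linepath p q) (\<lambda>z. f z u))"
          unfolding contour_integral_integral[of "linepath 0 1"]
          by (rule Henstock_Kurzweil_Integration.integral_cong) (auto simp: linepath_def)
        finally show "contour_integral (linepath p q) (\<lambda>z. integral {0..1} (f z)) =
          integral {0..1} (\<lambda>u. contour_integral (linepath p q) (\<lambda>z. f z u))" by (simp add: eq)
        have c2: "continuous_on ({0..1} \<times> {0..1}) (\<lambda>(u, t). f (linepath p q t) u * (q - p))"
        proof -
          have "continuous_on ({0..1} \<times> {0..1}) ((\<lambda>(z, u). f z u) \<circ> (\<lambda>(u, t). (linepath p q t, u)))"
          proof (rule continuous_on_compose)
            show "continuous_on ({0..1} \<times> {0..1}) (\<lambda>(u, t). (linepath p q t, u))"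
              by (auto simp: case_prod_unfold linepath_def intro!: continuous_intros)
            show "continuous_on ((\<lambda>(u, t). (linepath p q t, u)) ` ({0..1} \<times> {0..1})) (\<lambda>(z, u). f z u)"
              by (rule continuous_on_subset[OF cont]) (use pq in \<open>auto simp: linepath_in_path subset_iff\<close>)
          qed
          thus ?thesis by (auto simp: o_def case_prod_unfold intro!: continuous_intros)
        qed
        have "continuous_on {0..1} (\<lambda>u. integral {0..1} (\<lambda>t. f (linepath p q t) u * (q - p)))"
          using integral_continuous_on_param[of "{0..1}" 0 1 "\<lambda>u t. f (linepath p q t) u * (q - p)"] c2
          by simp
        thus "(\<lambda>u. contour_integral (linepath p q) (\<lambda>z. f z u)) integrable_on {0..1}"
          by (simp add: contour_integral_integral integrable_continuous_real)
      qed
      have seg: "closed_segment a b \<subseteq> U" "closed_segment b c \<subseteq> U" "closed_segment c a \<subseteq> U"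
        using hull segments_subset_convex_hull(1)[of a b c] segments_subset_convex_hull(3)[of b c a]
          segments_subset_convex_hull(5)[of c a b] by (blast intro: order_trans)+
      have "integral {0..1} (\<lambda>u. contour_integral (linepath a b) (\<lambda>z. f z u)) +
         integral {0..1} (\<lambda>u. contour_integral (linepath b c) (\<lambda>z. f z u)) +
         integral {0..1} (\<lambda>u. contour_integral (linepath c a) (\<lambda>z. f z u)) =
         integral {0..1} (\<lambda>u. contour_integral (linepath a b) (\<lambda>z. f z u) +
            contour_integral (linepath b c) (\<lambda>z. f z u) + contour_integral (linepath c a) (\<lambda>z. f z u))"
        using int seg by (simp add: Henstock_Kurzweil_Integration.integral_add integrable_add)
      also have "\<dots> = integral {0..1} (\<lambda>u :: real. 0 :: complex)"
      proof (rule Henstock_Kurzweil_Integration.integral_cong)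
        fix u :: real assume u: "u \<in> {0..1}"
        have hol: "(\<lambda>z. f z u) holomorphic_on convex hull {a, b, c}"
          using holo[OF u] hull holomorphic_on_subset by blast
        have ci: "(\<lambda>z. f z u) contour_integrable_on linepath p q" if "closed_segment p q \<subseteq> U" for p q
          using that holo[OF u] holomorphic_on_imp_continuous_on continuous_on_subset
          by (intro contour_integrable_continuous_linepath) blast
        have "((\<lambda>z. f z u) has_contour_integral 0) (linepath a b +++ linepath b c +++ linepath c a)"
          using Cauchy_theorem_triangle[OF hol] .
        from contour_integral_unique[OF this]
        show "contour_integral (linepath a b) (\<lambda>z. f z u) +
            contour_integral (linepath b c) (\<lambda>z. f z u) + contour_integral (linepath c a) (\<lambda>z. f z u) = 0"
          using ci seg by (simp add: contour_integrable_join add.assoc)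
      qed
      finally show "contour_integral (linepath a b) (\<lambda>z. integral {0..1} (f z)) +
       contour_integral (linepath b c) (\<lambda>z. integral {0..1} (f z)) +
       contour_integral (linepath c a) (\<lambda>z. integral {0..1} (f z)) = 0"
        using swap seg by simp
    qed
  qed
  thus ?thesis by (rule analytic_imp_holomorphic)
qed

section \<open>The Dirichlet series for Re s > 1 and its recursive continuation\<close>

definition hz_series :: "complex \<Rightarrow> real \<Rightarrow> complex" where
  "hz_series s x = (\<Sum>n. of_real (real n + x) powr (- s))"

text \<open>
  \<open>hurwitz_aux k s x\<close> is \<open>(s - 1) \<zeta>(s, x)\<close> on the half plane \<open>Re s > 1 - k\<close>. The recursion is Taylor's
  formula for \<open>\<zeta>(s, x + u)\<close> in \<open>u\<close>, averaged over \<open>[0, 1]\<close>: the mean of \<open>\<zeta>(s, x + u)\<close> telescopes to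
  \<open>x\<close> to the power \<open>1 - s\<close> over \<open>s - 1\<close>, and the \<open>x\<close>-derivative of \<open>\<zeta>(s, x)\<close> is \<open>-s \<zeta>(s + 1, x)\<close>.
\<close>

fun hurwitz_aux :: "nat \<Rightarrow> complex \<Rightarrow> real \<Rightarrow> complex" where
  "hurwitz_aux 0 s x = (s - 1) * hz_series s x"
| "hurwitz_aux (Suc k) s x = of_real x powr (1 - s) +
     (s - 1) * integral {0..1} (\<lambda>u. of_real (1 - u) * hurwitz_aux k (s + 1) (x + u))"

lemma norm_of_real_powr: "y > 0 \<Longrightarrow> norm (of_real y powr s :: complex) = y powr Re s"
  by (simp add: norm_powr_real_powr)

text \<open>The index starts at \<open>Suc n\<close> because x^(-s) is unbounded as x tends to 0.
  With the head term split off, the majorant is uniform in all x > 0.\<close>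

lemma hz_term_bound:
  assumes "x > 0" "Re s \<ge> a" "a \<ge> 0"
  shows "norm (of_real (real (Suc n) + x) powr (- s) :: complex) \<le> real (Suc n) powr - a"
proof -
  have "norm (of_real (real (Suc n) + x) powr (- s) :: complex) = (real (Suc n) + x) powr - Re s"
    using assms by (subst norm_of_real_powr) auto
  also have "\<dots> \<le> (real (Suc n) + x) powr - a"
    using assms by (intro powr_mono) auto
  also have "\<dots> \<le> real (Suc n) powr - a"
    using assms by (intro powr_mono2') auto
  finally show ?thesis .
qed

lemma summable_Suc_powr: "a > 1 \<Longrightarrow> summable (\<lambda>n. real (Suc n) powr - a)"
  using summable_Suc_iff[of "\<lambda>n. real n powr - a"] by (simp add: summable_real_powr_iff del: of_nat_Suc)

lemma summable_hz:
  assumes "x > 0" "Re s > 1"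
  shows "summable (\<lambda>n. of_real (real n + x) powr (- s) :: complex)"
proof -
  have "summable (\<lambda>n. of_real (real (Suc n) + x) powr (- s) :: complex)"
    by (rule summable_comparison_test'[OF summable_Suc_powr[of "Re s"], of 0])
       (use assms hz_term_bound[of x "Re s" s] in auto)
  thus ?thesis by (subst summable_Suc_iff[symmetric])
qed

lemma hz_series_split:
  assumes "x > 0" "Re s > 1"
  shows "hz_series s x = of_real x powr (- s) + (\<Sum>n. of_real (real (Suc n) + x) powr (- s))"
  using suminf_split_head[OF summable_hz[OF assms]] by (simp add: hz_series_def)

lemma uniform_limit_hz:
  assumes "a > 1"
  shows "uniform_limit ({s. Re s \<ge> a} \<times> {0<..})
    (\<lambda>n (s, x). \<Sum>i<n. of_real (real (Suc i) + x) powr (- s) :: complex)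
    (\<lambda>(s, x). \<Sum>n. of_real (real (Suc n) + x) powr (- s)) sequentially"
  unfolding case_prod_unfold
  by (rule Weierstrass_m_test[OF _ summable_Suc_powr[OF assms]])
     (use assms hz_term_bound[of _ a] in auto)

lemma continuous_on_hz_series:
  "continuous_on ({s. Re s > 1} \<times> {0<..}) (\<lambda>(s, x). hz_series s x)"
proof -
  have "continuous_on ({s. Re s > a} \<times> {0<..}) (\<lambda>(s, x). hz_series s x)" if a: "a > 1" for a
  proof -
    have "continuous_on ({s. Re s \<ge> a} \<times> {0<..}) (\<lambda>(s, x). \<Sum>n. of_real (real (Suc n) + x) powr (- s) :: complex)"
      by (rule uniform_limit_theorem[OF _ uniform_limit_hz[OF a]])
         (auto simp: case_prod_unfold complex_eq_iff intro!: continuous_intros always_eventually)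
    hence "continuous_on ({s. Re s \<ge> a} \<times> {0<..}) (\<lambda>(s, x). of_real x powr (- s) +
        (\<Sum>n. of_real (real (Suc n) + x) powr (- s) :: complex))"
      by (auto simp: case_prod_unfold intro!: continuous_intros)
    hence "continuous_on ({s. Re s > a} \<times> {0<..}) (\<lambda>(s, x). of_real x powr (- s) +
        (\<Sum>n. of_real (real (Suc n) + x) powr (- s) :: complex))"
      by (rule continuous_on_subset) auto
    thus ?thesis
      by (rule continuous_on_eq) (use a hz_series_split in auto)
  qed
  hence "continuous_on (\<Union>a\<in>{1<..}. {s. Re s > a} \<times> {0<..}) (\<lambda>(s, x). hz_series s x)"
    by (intro continuous_on_open_UN) (auto intro!: open_Times open_halfspace_Re_gt)
  moreover have "{s. Re s > 1} \<times> {0::real<..} \<subseteq> (\<Union>a\<in>{1<..}. {s. Re s > a} \<times> {0<..})"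
    using dense by fastforce
  ultimately show ?thesis by (rule continuous_on_subset)
qed

lemma holomorphic_on_hz_series:
  assumes "x > 0"
  shows "(\<lambda>s. hz_series s x) holomorphic_on {s. Re s > 1}"
proof -
  have "(\<lambda>s. \<Sum>n. of_real (real (Suc n) + x) powr (- s) :: complex) holomorphic_on {s. Re s > 1}"
  proof (rule holomorphic_uniform_sequence[where f = "\<lambda>n s. \<Sum>i<n. of_real (real (Suc i) + x) powr (- s)"])
    fix z :: complex assume z: "z \<in> {s. Re s > 1}"
    define d where "d = (Re z - 1) / 2"
    have sub: "cball z d \<subseteq> {s. Re s \<ge> 1 + d}"
    proof
      fix w assume "w \<in> cball z d"
      hence "\<bar>Re (z - w)\<bar> \<le> d" using abs_Re_le_cmod[of "z - w"] by (simp add: dist_norm)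
      moreover have "Re z = 1 + 2 * d" by (simp add: d_def field_simps)
      ultimately show "w \<in> {s. Re s \<ge> 1 + d}" by auto
    qed
    have d: "d > 0" using z by (simp add: d_def)
    have "uniform_limit (cball z d) (\<lambda>n s. \<Sum>i<n. of_real (real (Suc i) + x) powr (- s) :: complex)
      (\<lambda>s. \<Sum>n. of_real (real (Suc n) + x) powr (- s)) sequentially"
      by (rule Weierstrass_m_test[OF _ summable_Suc_powr[of "1 + d"]])
         (use assms d sub hz_term_bound[of x "1 + d"] in auto)
    thus "\<exists>d>0. cball z d \<subseteq> {s. Re s > 1} \<and> uniform_limit (cball z d)
      (\<lambda>n s. \<Sum>i<n. of_real (real (Suc i) + x) powr (- s) :: complex)
      (\<lambda>s. \<Sum>n. of_real (real (Suc n) + x) powr (- s)) sequentially"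
      using d sub by (intro exI[of _ d]) auto
  qed (use assms in \<open>auto simp: open_halfspace_Re_gt intro!: holomorphic_intros\<close>)
  hence "(\<lambda>s. of_real x powr (- s) + (\<Sum>n. of_real (real (Suc n) + x) powr (- s) :: complex)) holomorphic_on {s. Re s > 1}"
    using assms by (auto intro!: holomorphic_intros)
  thus ?thesis
    by (rule holomorphic_transform) (use hz_series_split[OF assms] in auto)
qed

text \<open>Continuity is needed jointly in s and x, since the recursion integrates over a shift of
  x while s varies.\<close>

lemma continuous_on_hurwitz_aux:
  "continuous_on ({s. Re s > 1 - real k} \<times> {0<..}) (\<lambda>(s, x). hurwitz_aux k s x)"
proof (induction k)
  case 0
  show ?case
    using continuous_on_hz_series by (auto simp: case_prod_unfold intro!: continuous_intros)
next
  case (Suc k)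
  let ?S = "{s. Re s > 1 - real (Suc k)} \<times> {0::real<..}"
  have "continuous_on (?S \<times> {0..1}) ((\<lambda>(s, x). hurwitz_aux k s x) \<circ> (\<lambda>p. (fst (fst p) + 1, snd (fst p) + snd p)))"
    by (rule continuous_on_compose[OF _ continuous_on_subset[OF Suc]]) (auto intro!: continuous_intros)
  hence "continuous_on (?S \<times> cbox 0 1)
      (\<lambda>(p, u). of_real (1 - u) * hurwitz_aux k (fst p + 1) (snd p + u))"
    by (auto simp: case_prod_unfold o_def intro!: continuous_intros)
  from integral_continuous_on_param[OF this]
  have "continuous_on ?S (\<lambda>p. integral {0..1} (\<lambda>u. of_real (1 - u) * hurwitz_aux k (fst p + 1) (snd p + u)))"
    by simp
  thus ?case by (auto simp: case_prod_unfold intro!: continuous_intros)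
qed

lemma continuous_on_hurwitz_aux_shift:
  assumes "x > 0"
  shows "continuous_on ({s. Re s > - real k} \<times> {0..1})
    (\<lambda>(s, u). of_real (1 - u) * hurwitz_aux k (s + 1) (x + u))"
proof -
  have "continuous_on ({s. Re s > - real k} \<times> {0..1})
      ((\<lambda>(s, x). hurwitz_aux k s x) \<circ> (\<lambda>p. (fst p + 1, x + snd p)))"
    by (rule continuous_on_compose[OF _ continuous_on_subset[OF continuous_on_hurwitz_aux]])
       (use assms in \<open>auto intro!: continuous_intros\<close>)
  thus ?thesis by (auto simp: case_prod_unfold o_def intro!: continuous_intros)
qed

lemma holomorphic_on_hurwitz_aux:
  "x > 0 \<Longrightarrow> (\<lambda>s. hurwitz_aux k s x) holomorphic_on {s. Re s > 1 - real k}"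
proof (induction k arbitrary: x)
  case 0
  thus ?case using holomorphic_on_hz_series by (auto intro!: holomorphic_intros)
next
  case (Suc k)
  let ?S = "{s. Re s > 1 - real (Suc k)}"
  have S: "?S = {s. Re s > - real k}" by auto
  have "(\<lambda>s. integral {0..1} (\<lambda>u. of_real (1 - u) * hurwitz_aux k (s + 1) (x + u))) holomorphic_on ?S"
  proof (rule holomorphic_on_integral_param)
    show "continuous_on (?S \<times> {0..1}) (\<lambda>(s, u). of_real (1 - u) * hurwitz_aux k (s + 1) (x + u))"
      unfolding S using Suc.prems by (rule continuous_on_hurwitz_aux_shift)
    fix u :: real assume "u \<in> {0..1}"
    hence "(\<lambda>s. hurwitz_aux k s (x + u)) holomorphic_on {s. Re s > 1 - real k}"
      using Suc by simp
    hence "(\<lambda>s. hurwitz_aux k s (x + u)) \<circ> (\<lambda>s. s + 1) holomorphic_on ?S"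
      by (intro holomorphic_on_compose_gen[of _ _ _ "{s. Re s > 1 - real k}"]) (auto intro!: holomorphic_intros)
    thus "(\<lambda>s. of_real (1 - u) * hurwitz_aux k (s + 1) (x + u)) holomorphic_on ?S"
      by (auto simp: o_def intro!: holomorphic_intros)
  qed (rule open_halfspace_Re_gt)
  thus ?case using Suc.prems by (auto intro!: holomorphic_intros)
qed

text \<open>Taylor's formula for a single term: the remainder integral is the value of (y+u)^(-s) at
  u = 0 minus its mean over [0, 1]. \<open>H\<close> is the antiderivative found by one integration
  by parts.\<close>

lemma has_integral_hz_kernel:
  fixes s :: complex
  assumes "y > 0" "s \<noteq> 1"
  shows "((\<lambda>u. of_real (1 - u) * (s * of_real (y + u) powr (- s - 1))) has_integral
    of_real y powr (- s) - (of_real (y + 1) powr (1 - s) - of_real y powr (1 - s)) / (1 - s)) {0..1}"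
proof -
  define H :: "real \<Rightarrow> complex" where
    "H u = - (of_real (1 - u) * of_real (y + u) powr (- s)) - of_real (y + u) powr (1 - s) / (1 - s)" for u
  have "((\<lambda>u. of_real (1 - u) * (s * of_real (y + u) powr (- s - 1))) has_integral (H 1 - H 0)) {0..1}"
  proof (rule fundamental_theorem_of_calculus)
    fix u :: real assume u: "u \<in> {0..1}"
    have D: "((\<lambda>u. complex_of_real (y + u) powr w) has_vector_derivative w * of_real (y + u) powr (w - 1)) (at u within {0..1})" for w
    proof -
      have "((\<lambda>z. (of_real y + z) powr w) has_field_derivative w * of_real (y + u) powr (w - 1)) (at (of_real u))"
        using u assms by (auto intro!: derivative_eq_intros simp flip: of_real_add)
      from has_vector_derivative_real_field[OF this] show ?thesis
        by (simp add: o_def)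
    qed
    have "((\<lambda>u. complex_of_real (1 - u)) has_vector_derivative - 1) (at u within {0..1})"
      by (rule has_vector_derivative_eq_rhs, (rule derivative_intros has_vector_derivative_of_real)+) auto
    hence "(H has_vector_derivative - (of_real (1 - u) * (- s * of_real (y + u) powr (- s - 1)) + (- 1) * of_real (y + u) powr (- s))
        - (1 - s) * of_real (y + u) powr (1 - s - 1) / (1 - s)) (at u within {0..1})"
      unfolding H_def
      by (intro has_vector_derivative_diff has_vector_derivative_minus has_vector_derivative_mult
          has_vector_derivative_divide D)
    moreover have "- (of_real (1 - u) * (- s * of_real (y + u) powr (- s - 1)) + (- 1) * of_real (y + u) powr (- s))
        - (1 - s) * of_real (y + u) powr (1 - s - 1) / (1 - s) = of_real (1 - u) * (s * of_real (y + u) powr (- s - 1))"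
      using assms by simp
    ultimately show "(H has_vector_derivative of_real (1 - u) * (s * of_real (y + u) powr (- s - 1))) (at u within {0..1})"
      by simp
  qed simp
  moreover have "H 1 - H 0 = of_real y powr (- s) - (of_real (y + 1) powr (1 - s) - of_real y powr (1 - s)) / (1 - s)"
    by (simp add: H_def diff_divide_distrib)
  ultimately show ?thesis by simp
qed

text \<open>Clearing the denominator extends the identity to s = 1, where both sides vanish. The
  half planes of \<open>hurwitz_aux k\<close> with k > 0 contain this point.\<close>

lemma integral_hz_kernel:
  fixes s :: complex
  assumes "y > 0"
  shows "(s - 1) * integral {0..1} (\<lambda>u. of_real (1 - u) * (s * of_real (y + u) powr (- s - 1))) =
    (s - 1) * of_real y powr (- s) + of_real (y + 1) powr (1 - s) - of_real y powr (1 - s)"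
proof (cases "s = 1")
  case False
  thus ?thesis using integral_unique[OF has_integral_hz_kernel[OF assms False]]
    by (simp add: field_simps)
next
  case True
  have "complex_of_real y + 1 \<noteq> 0" using assms by (auto simp: complex_eq_iff)
  thus ?thesis using True assms by simp
qed

lemma tendsto_of_real_powr_zero:
  assumes "Re w < 0"
  shows "(\<lambda>n. of_real (real n + x) powr w :: complex) \<longlonglongrightarrow> 0"
proof (rule tendsto_norm_zero_cancel, rule Lim_transform_eventually)
  have "filterlim (\<lambda>n. real n + x) at_top sequentially"
    using filterlim_tendsto_add_at_top[OF tendsto_const filterlim_real_sequentially, of x]
    by (simp add: add.commute)
  thus "(\<lambda>n. (real n + x) powr Re w) \<longlonglongrightarrow> 0"
    using tendsto_neg_powr[OF assms] by blast
  show "\<forall>\<^sub>F n in sequentially. (real n + x) powr Re w = norm (of_real (real n + x) powr w :: complex)"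
    using eventually_gt_at_top[of "nat \<lceil>\<bar>x\<bar>\<rceil>"]
  proof eventually_elim
    case (elim n)
    hence "real n + x > 0" by linarith
    thus ?case by (simp only: norm_of_real_powr)
  qed
qed

text \<open>The content is in k = 0: summing \<open>integral_hz_kernel\<close> over y = n + x
  telescopes the powers (n+x)^(1-s) to -x^(1-s), and uniform convergence moves the sum under the
  integral. For larger k both sides are the same recursion applied to integrands that agree by
  induction.\<close>

lemma hurwitz_aux_step:
  assumes "x > 0" "Re s > 1 - real k"
  shows "hurwitz_aux (Suc k) s x = hurwitz_aux k s x"
  using assms
proof (induction k arbitrary: s x)
  case 0
  define f where "f n u = of_real (1 - u) * (s * of_real (real n + x + u) powr (- s - 1))" for n u
  define A where "A n = integral {0..1} (f n)" for n
  have cont: "continuous_on {0..1} (f n)" for n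
    unfolding f_def using 0 by (auto intro!: continuous_intros simp: complex_eq_iff)
  have "uniform_limit {0..1} (\<lambda>n u. \<Sum>i<n. f (Suc i) u) (\<lambda>u. \<Sum>i. f (Suc i) u) sequentially"
  proof (rule Weierstrass_m_test)
    show "summable (\<lambda>n. norm s * real (Suc n) powr - (Re s + 1))"
      using 0 by (intro summable_mult summable_Suc_powr) auto
    fix n and u :: real assume u: "u \<in> {0..1}"
    have "norm (f (Suc n) u) = (1 - u) * (norm s * norm (of_real (real (Suc n) + (x + u)) powr - (s + 1) :: complex))"
      using u unfolding f_def norm_mult norm_of_real by (simp add: add.assoc)
    also have "\<dots> \<le> 1 * (norm s * real (Suc n) powr - (Re s + 1))"
      using u 0 by (intro mult_mono hz_term_bound mult_nonneg_nonneg) auto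
    finally show "norm (f (Suc n) u) \<le> norm s * real (Suc n) powr - (Re s + 1)" by simp
  qed
  then obtain I J where
    I: "\<And>n. ((\<lambda>u. \<Sum>i<n. f (Suc i) u) has_integral I n) {0..1}"
    and J: "((\<lambda>u. \<Sum>i. f (Suc i) u) has_integral J) {0..1}" and IJ: "I \<longlonglongrightarrow> J"
    by (rule uniform_limit_integral) (auto intro!: continuous_on_sum cont)
  have "I n = (\<Sum>i<n. A (Suc i))" for n
    using integral_unique[OF I[of n]] cont unfolding A_def
    by (subst (asm) Henstock_Kurzweil_Integration.integral_sum) (auto intro: integrable_continuous_real)
  hence "I = (\<lambda>n. \<Sum>i<n. A (Suc i))" by (rule ext)
  hence "(\<lambda>n. A (Suc n)) sums J"
    using IJ by (simp only: sums_def)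
  hence AJ: "A sums (A 0 + J)" by (subst (asm) sums_Suc_iff) (simp add: add.commute)
  have int0: "(f 0) integrable_on {0..1}" using cont by (intro integrable_continuous_real)
  have fs: "(\<lambda>n. f n u) sums (of_real (1 - u) * (s * hz_series (s + 1) (x + u)))" if "u \<in> {0..1}" for u
    unfolding f_def hz_series_def
    using summable_hz[of "x + u" "s + 1"] that 0
    by (intro sums_mult) (auto simp: add.assoc summable_sums)
  have "((\<lambda>u. f 0 u + (\<Sum>i. f (Suc i) u)) has_integral (A 0 + J)) {0..1}"
    unfolding A_def using int0 J by (intro has_integral_add integrable_integral)
  hence "((\<lambda>u. of_real (1 - u) * (s * hz_series (s + 1) (x + u))) has_integral (A 0 + J)) {0..1}"
  proof (rule has_integral_eq[rotated])
    fix u :: real assume "u \<in> {0..1}"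
    from fs[OF this] have "summable (\<lambda>n. f n u)" "(\<Sum>n. f n u) = of_real (1 - u) * (s * hz_series (s + 1) (x + u))"
      by (simp_all only: sums_iff)
    thus "f 0 u + (\<Sum>i. f (Suc i) u) = of_real (1 - u) * (s * hz_series (s + 1) (x + u))"
      using suminf_split_head[of "\<lambda>n. f n u"] by (simp only:) simp
  qed
  hence J': "integral {0..1} (\<lambda>u. of_real (1 - u) * (s * hz_series (s + 1) (x + u))) = A 0 + J"
    by (rule integral_unique)
  have "(\<lambda>n. (s - 1) * A n) sums ((s - 1) * (A 0 + J))" by (rule sums_mult[OF AJ])
  moreover have "(\<lambda>n. (s - 1) * A n) sums ((s - 1) * hz_series s x - of_real x powr (1 - s))"
  proof -
    have "(\<lambda>n. of_real (real (Suc n) + x) powr (1 - s) - of_real (real n + x) powr (1 - s)) sums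
        (0 - of_real (real 0 + x) powr (1 - s) :: complex)"
      using 0 by (intro telescope_sums tendsto_of_real_powr_zero) auto
    moreover have "(\<lambda>n. (s - 1) * of_real (real n + x) powr (- s)) sums ((s - 1) * hz_series s x)"
      unfolding hz_series_def using summable_hz 0 by (intro sums_mult summable_sums) auto
    ultimately have "(\<lambda>n. (s - 1) * of_real (real n + x) powr (- s) +
        (of_real (real (Suc n) + x) powr (1 - s) - of_real (real n + x) powr (1 - s))) sums
        ((s - 1) * hz_series s x + (0 - of_real (real 0 + x) powr (1 - s)))"
      by (intro sums_add)
    moreover have "(s - 1) * A n = (s - 1) * of_real (real n + x) powr (- s) +
        (of_real (real (Suc n) + x) powr (1 - s) - of_real (real n + x) powr (1 - s))" for n
      using integral_hz_kernel[of "real n + x" s] 0 unfolding A_def f_def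
      by (simp add: algebra_simps)
    ultimately show ?thesis by simp
  qed
  ultimately have "(s - 1) * (A 0 + J) = (s - 1) * hz_series s x - of_real x powr (1 - s)"
    by (rule sums_unique2)
  with J' show ?case by (simp add: algebra_simps)
next
  case (Suc k)
  have "integral {0..1} (\<lambda>u. of_real (1 - u) * hurwitz_aux (Suc k) (s + 1) (x + u)) =
        integral {0..1} (\<lambda>u. of_real (1 - u) * hurwitz_aux k (s + 1) (x + u))"
  proof (rule Henstock_Kurzweil_Integration.integral_cong)
    fix u :: real assume "u \<in> {0..1}"
    hence "hurwitz_aux (Suc k) (s + 1) (x + u) = hurwitz_aux k (s + 1) (x + u)"
      using Suc.prems by (intro Suc.IH) auto
    thus "of_real (1 - u) * hurwitz_aux (Suc k) (s + 1) (x + u) = of_real (1 - u) * hurwitz_aux k (s + 1) (x + u)"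
      by (simp only:)
  qed
  thus ?case by (simp only: hurwitz_aux.simps(2))
qed

lemma hurwitz_aux_agree:
  assumes "x > 0" "Re s > 1 - real k" "k \<le> l"
  shows "hurwitz_aux l s x = hurwitz_aux k s x"
  using assms(3)
proof (induction rule: dec_induct)
  case (step n)
  thus ?case using hurwitz_aux_step[of x n s] assms by auto
qed simp

text \<open>This is \<zeta>(s, x) = x^(-s) + \<zeta>(s, x+1), multiplied by s - 1. In the induction
  the two boundary terms x^(1-s) and (x+1)^(1-s) differ by exactly what
  \<open>integral_hz_kernel\<close> supplies.\<close>

lemma hurwitz_aux_plus_one:
  assumes "x > 0" "Re s > 1 - real k"
  shows "hurwitz_aux k s x = (s - 1) * of_real x powr (- s) + hurwitz_aux k s (x + 1)"
  using assms
proof (induction k arbitrary: s x)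
  case 0
  have "hz_series s x = of_real x powr (- s) + hz_series s (x + 1)"
    using hz_series_split[of x s] 0 by (simp add: hz_series_def add.assoc add.commute[of 1])
  thus ?case by (simp add: algebra_simps)
next
  case (Suc k)
  have cont: "continuous_on {0..1} (\<lambda>u. of_real (1 - u) * hurwitz_aux k (s + 1) (y + u))" if "y > 0" for y
  proof -
    have "continuous_on {0..1} ((\<lambda>(s, u). of_real (1 - u) * hurwitz_aux k (s + 1) (y + u)) \<circ> (\<lambda>u. (s, u)))"
      by (rule continuous_on_compose[OF _ continuous_on_subset[OF continuous_on_hurwitz_aux_shift[OF that, of k]]])
         (use Suc.prems in \<open>auto intro!: continuous_intros\<close>)
    thus ?thesis by (simp add: o_def)
  qed
  have cont2: "continuous_on {0..1} (\<lambda>u. of_real (1 - u) * (s * of_real (x + u) powr (- s - 1)))"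
    using Suc.prems by (auto intro!: continuous_intros simp: complex_eq_iff)
  have "integral {0..1} (\<lambda>u. of_real (1 - u) * hurwitz_aux k (s + 1) (x + u)) =
        integral {0..1} (\<lambda>u. of_real (1 - u) * (s * of_real (x + u) powr (- s - 1)) +
          of_real (1 - u) * hurwitz_aux k (s + 1) (x + 1 + u))"
  proof (rule Henstock_Kurzweil_Integration.integral_cong)
    fix u :: real assume u: "u \<in> {0..1}"
    have "hurwitz_aux k (s + 1) (x + u) = (s + 1 - 1) * of_real (x + u) powr - (s + 1) + hurwitz_aux k (s + 1) (x + u + 1)"
      using u Suc.prems by (intro Suc.IH) auto
    moreover have "x + u + 1 = x + 1 + u" "- (s + 1) = - s - 1" "s + 1 - 1 = s" by simp_all
    ultimately have "hurwitz_aux k (s + 1) (x + u) = s * of_real (x + u) powr (- s - 1) + hurwitz_aux k (s + 1) (x + 1 + u)"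
      by metis
    thus "of_real (1 - u) * hurwitz_aux k (s + 1) (x + u) = of_real (1 - u) * (s * of_real (x + u) powr (- s - 1)) +
          of_real (1 - u) * hurwitz_aux k (s + 1) (x + 1 + u)"
      by (simp only: distrib_left)
  qed
  also have "\<dots> = integral {0..1} (\<lambda>u. of_real (1 - u) * (s * of_real (x + u) powr (- s - 1))) +
      integral {0..1} (\<lambda>u. of_real (1 - u) * hurwitz_aux k (s + 1) (x + 1 + u))"
    using cont[of "x + 1"] cont2 Suc.prems
    by (intro Henstock_Kurzweil_Integration.integral_add integrable_continuous_real) auto
  finally show ?case
    using integral_hz_kernel[of x s] Suc.prems
    by (simp only: hurwitz_aux.simps(2) distrib_left) (simp add: algebra_simps)
qed

lemma hurwitz_aux_plus_nat:
  assumes "x > 0" "Re s > 1 - real k"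
  shows "hurwitz_aux k s x = (s - 1) * (\<Sum>n<N. of_real (real n + x) powr (- s)) + hurwitz_aux k s (x + real N)"
proof (induction N)
  case (Suc N)
  thus ?case using hurwitz_aux_plus_one[of "x + real N" k s] assms
    by (simp add: algebra_simps)
qed simp

text \<open>Each level of the recursion costs a factor s + j - 1, bounded by A, and gains a factor
  1/x; since A \<le> x, each of the k boundary terms is at most x^(1 - Re s). The real part rises by
  1 per level, so Re s + k \<ge> 2 puts the innermost series where the sum of inverse squares
  dominates it. That series carries one more factor s + k - 1, whence the exponent k + 1 of
  A.\<close>

lemma norm_hurwitz_aux_le:
  assumes "1 \<le> x" "A \<le> x" "0 \<le> A" "Re s \<ge> 0" "Re s + real k \<ge> 2"
    and "\<And>j. j \<le> k \<Longrightarrow> norm (s + of_nat j - 1) \<le> A"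
  shows "norm (hurwitz_aux k s x) \<le> real k * x powr (1 - Re s) + 2 * A ^ Suc k * x powr (2 - Re s - real k)"
  using assms
proof (induction k arbitrary: s x)
  case 0
  have bd: "norm (of_real (real n + x) powr (- s) :: complex) \<le> x powr (2 - Re s) * (1 / real (Suc n) ^ 2)" for n
  proof -
    have "norm (of_real (real n + x) powr (- s) :: complex) = (real n + x) powr ((2 - Re s) + (- 2))"
      using 0 by (subst norm_of_real_powr) auto
    also have "\<dots> = (real n + x) powr (2 - Re s) * (real n + x) powr (- 2)" by (rule powr_add)
    also have "\<dots> \<le> x powr (2 - Re s) * real (Suc n) powr (- 2)"
      using 0 by (intro mult_mono powr_mono2') auto
    also have "real (Suc n) powr (- 2) = 1 / real (Suc n) ^ 2"
      by (simp add: powr_minus powr_numeral divide_inverse del: of_nat_Suc)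
    finally show ?thesis .
  qed
  have sums: "(\<lambda>n. x powr (2 - Re s) * (1 / real (Suc n) ^ 2)) sums (x powr (2 - Re s) * (pi\<^sup>2 / 6))"
    using inverse_squares_sums by (intro sums_mult) (simp add: add.commute)
  have "norm (hz_series s x) \<le> x powr (2 - Re s) * (pi\<^sup>2 / 6)"
    unfolding hz_series_def by (rule norm_suminf_le[OF _ sums_summable[OF sums], unfolded sums_unique[OF sums, symmetric]]) (rule bd)
  also have "\<dots> \<le> x powr (2 - Re s) * 2"
  proof -
    have "pi\<^sup>2 \<le> 3.2\<^sup>2"
      using pi_approx by (intro power_mono) auto
    hence "pi\<^sup>2 / 6 \<le> 2" by (simp add: power2_eq_square)
    thus ?thesis by (intro mult_left_mono) auto
  qed
  finally have "norm (hz_series s x) \<le> x powr (2 - Re s) * 2" .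
  moreover have "norm (s - 1) \<le> A" using 0(6)[of 0] by simp
  ultimately have "norm (s - 1) * norm (hz_series s x) \<le> A * (x powr (2 - Re s) * 2)"
    using 0 by (intro mult_mono) auto
  thus ?case by (simp add: norm_mult mult_ac)
next
  case (Suc k)
  define B where "B = real k * x powr (- Re s) + 2 * A ^ Suc k * x powr (1 - Re s - real k)"
  have bd: "norm (of_real (1 - u) * hurwitz_aux k (s + 1) (x + u)) \<le> B" if u: "u \<in> {0..1}" for u
  proof -
    have "norm (hurwitz_aux k (s + 1) (x + u)) \<le>
        real k * (x + u) powr (1 - Re (s + 1)) + 2 * A ^ Suc k * (x + u) powr (2 - Re (s + 1) - real k)"
    proof (rule Suc.IH)
      fix j assume "j \<le> k"
      thus "norm (s + 1 + of_nat j - 1) \<le> A" using Suc.prems(6)[of "Suc j"] by (simp add: algebra_simps)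
    qed (use Suc.prems u in auto)
    also have "1 - Re (s + 1) = - Re s" by simp
    also have "2 - Re (s + 1) - real k = 1 - Re s - real k" by simp
    also have "real k * (x + u) powr (- Re s) + 2 * A ^ Suc k * (x + u) powr (1 - Re s - real k) \<le> B"
      unfolding B_def using Suc.prems u
      by (intro add_mono mult_left_mono powr_mono2' mult_nonneg_nonneg zero_le_power) auto
    finally have "norm (hurwitz_aux k (s + 1) (x + u)) \<le> B" .
    hence "(1 - u) * norm (hurwitz_aux k (s + 1) (x + u)) \<le> 1 * B"
      using u by (intro mult_mono) auto
    thus ?thesis using u by (simp add: norm_mult del: of_real_diff)
  qed
  have "norm (integral {0..1} (\<lambda>u. of_real (1 - u) * hurwitz_aux k (s + 1) (x + u))) \<le> B * (1 - 0)"
  proof (rule integral_bound)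
    have "continuous_on {0..1} ((\<lambda>(s, u). of_real (1 - u) * hurwitz_aux k (s + 1) (x + u)) \<circ> (\<lambda>u. (s, u)))"
      by (rule continuous_on_compose[OF _ continuous_on_subset[OF continuous_on_hurwitz_aux_shift[of x k]]])
         (use Suc.prems in \<open>auto intro!: continuous_intros\<close>)
    thus "continuous_on {0..1} (\<lambda>u. of_real (1 - u) * hurwitz_aux k (s + 1) (x + u))" by (simp add: o_def)
  qed (use bd in auto)
  moreover have "norm (s - 1) \<le> A" using Suc.prems(6)[of 0] by simp
  ultimately have "norm ((s - 1) * integral {0..1} (\<lambda>u. of_real (1 - u) * hurwitz_aux k (s + 1) (x + u))) \<le> A * B"
    unfolding norm_mult using Suc.prems by (intro mult_mono) auto
  moreover have "norm (of_real x powr (1 - s) :: complex) = x powr (1 - Re s)"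
    using Suc.prems by (subst norm_of_real_powr) auto
  ultimately have "norm (hurwitz_aux (Suc k) s x) \<le> x powr (1 - Re s) + A * B"
    by (simp only: hurwitz_aux.simps(2)) (smt (verit) norm_triangle_ineq)
  also have "A * B = real k * (A * x powr (- Re s)) + 2 * A ^ Suc (Suc k) * x powr (2 - Re s - real (Suc k))"
    by (simp add: B_def algebra_simps)
  finally have bound: "norm (hurwitz_aux (Suc k) s x) \<le> x powr (1 - Re s) + (real k * (A * x powr (- Re s)) +
      2 * A ^ Suc (Suc k) * x powr (2 - Re s - real (Suc k)))" .
  have "A * x powr (- Re s) \<le> x * x powr (- Re s)" using Suc.prems by (intro mult_right_mono) auto
  also have "\<dots> = x powr (1 - Re s)" using Suc.prems by (simp add: powr_mult_base)
  finally have "real k * (A * x powr (- Re s)) \<le> real k * x powr (1 - Re s)" by (rule mult_left_mono) auto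
  with bound show ?case by (simp only: of_nat_Suc distrib_right mult_1)
qed

section \<open>Identification with the Hurwitz zeta-function and truncation to a finite sum\<close>

lemma hurwitz_zeta_eq:
  assumes "x > 0" "Re s > 1 - real k" "s \<noteq> 1"
  shows "hurwitz_zeta s x = hurwitz_aux k s x / (s - 1)"
proof -
  define K where "K s = nat \<lceil>\<bar>Re s\<bar>\<rceil> + 2" for s :: complex
  have K: "Re s > 1 - real (K s)" for s unfolding K_def by linarith
  \<comment> \<open>\<open>F\<close> glues the continuations on the growing half planes, using at
    each s a level \<open>K s\<close> that reaches s. Division by zero gives F 1 = 0, the value that
    the definition prescribes at the pole.\<close>
  define F where "F s = hurwitz_aux (K s) s x / (s - 1)" for s
  have F: "F s = hurwitz_aux k s x / (s - 1)" if "Re s > 1 - real k" for s k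
  proof -
    have "hurwitz_aux (K s) s x = hurwitz_aux (max k (K s)) s x"
      using assms K by (intro hurwitz_aux_agree[symmetric]) auto
    also have "\<dots> = hurwitz_aux k s x" using assms that by (intro hurwitz_aux_agree) auto
    finally show ?thesis by (simp add: F_def)
  qed
  have "F holomorphic_on (\<Union>k. {s. Re s > 1 - real k} - {1})"
  proof (rule holomorphic_on_UN_open)
    fix k :: nat
    have "(\<lambda>s. hurwitz_aux k s x / (s - 1)) holomorphic_on ({s. Re s > 1 - real k} - {1})"
      by (intro holomorphic_intros holomorphic_on_subset[OF holomorphic_on_hurwitz_aux[OF assms(1)]]) auto
    thus "F holomorphic_on ({s. Re s > 1 - real k} - {1})"
      by (rule holomorphic_transform) (use F in auto)
    show "open ({s. Re s > 1 - real k} - {1})" by (intro open_Diff open_halfspace_Re_gt) auto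
  qed
  hence holo: "F holomorphic_on - {1}"
    by (rule holomorphic_on_subset) (use K in blast)
  have sums: "(\<lambda>n. of_real (real n + x) powr (- z)) sums F z" if "Re z > 1" for z
  proof -
    have "F z = hz_series z x" using F[of 0 z] that by auto
    thus ?thesis using summable_hz[OF assms(1) that] by (simp add: hz_series_def summable_sums)
  qed
  have "(THE f :: complex \<Rightarrow> complex. f holomorphic_on - {1} \<and>
        (\<forall>z. Re z > 1 \<longrightarrow> (\<lambda>n. of_real (real n + x) powr (- z)) sums f z) \<and> f 1 = 0) = F"
  proof (rule the_equality)
    show "F holomorphic_on - {1} \<and> (\<forall>z. Re z > 1 \<longrightarrow> (\<lambda>n. of_real (real n + x) powr (- z)) sums F z) \<and> F 1 = 0"
      using holo sums by (auto simp: F_def)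
    fix f :: "complex \<Rightarrow> complex"
    assume f: "f holomorphic_on - {1} \<and>
        (\<forall>z. Re z > 1 \<longrightarrow> (\<lambda>n. of_real (real n + x) powr (- z)) sums f z) \<and> f 1 = 0"
    have eq: "f z = F z" if "z \<noteq> 1" for z
    proof (rule analytic_continuation_open[of "{z. Re z > 1}" "- {1}" f F z])
      show "connected (- {1 :: complex})" by (intro connected_punctured_universe) auto
      have "2 \<in> {z :: complex. Re z > 1}" by simp
      thus "{z :: complex. Re z > 1} \<noteq> {}" by blast
      show "f z = F z" if "z \<in> {z. Re z > 1}" for z using f sums that sums_unique2 by blast
    qed (use f holo that in \<open>auto simp: open_halfspace_Re_gt\<close>)
    show "f = F"
      using eq f by (auto simp: F_def fun_eq_iff) (metis div_0 eq F_def diff_self div_by_0)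
  qed
  thus ?thesis unfolding hurwitz_zeta_def using F[OF assms(2)] by simp
qed

text \<open>The error is \<open>hurwitz_aux k s x / (s - 1)\<close> with x about T^(1+\<delta>).
  Each level of the recursion gains about |s|/x, hence T^(-\<delta>), so finitely many levels reduce
  the numerator to order x^(1-\<sigma>). Since |s - 1| \<ge> T/2 on the interval, the quotient has
  order T^((1+\<delta>)(1-\<sigma>)-1), which tends to 0.\<close>

lemma hurwitz_zeta_approx:
  fixes \<sigma> \<delta> \<alpha> \<epsilon> :: real
  assumes "0 < \<sigma>" "\<sigma> < 1" "0 < \<delta>" "(1 + \<delta>) * (1 - \<sigma>) < 1" "0 < \<alpha>" "\<alpha> < 1" "0 < \<epsilon>"
  shows "\<forall>\<^sub>F T in at_top. \<forall>t\<in>{T/2..T}. norm (hurwitz_zeta (Complex \<sigma> t) \<alpha> -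
    (\<Sum>n<nat \<lfloor>T powr (1 + \<delta>)\<rfloor>. of_real (real n + \<alpha>) powr (- Complex \<sigma> t))) < \<epsilon>"
proof -
  \<comment> \<open>Chosen so that 2 + \<delta> - k \<delta> \<le> 0: this is the exponent of T in
    A^(k+1) x^(1-k) when A has order T and x has order T^(1+\<delta>).\<close>
  define k where "k = nat \<lceil>2 / \<delta>\<rceil> + 2"
  have k2: "real k \<ge> 2" by (simp add: k_def)
  have kd: "real k * \<delta> \<ge> 2 + \<delta>"
  proof -
    have "real k \<ge> 2 / \<delta> + 1" unfolding k_def by linarith
    hence "real k * \<delta> \<ge> (2 / \<delta> + 1) * \<delta>" using assms by (intro mult_right_mono) auto
    thus ?thesis using assms by (simp add: algebra_simps)
  qed
  \<comment> \<open>The factor 4^k collects 2^(k+1) from A \<le> 2 T and 2^(k-1) from x \<ge> Y/2,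
    with Y = T^(1+\<delta>).\<close>
  define C where "C = real k + 2 * 4 ^ k"
  define B where "B T = 2 / T * ((2 * T powr (1 + \<delta>)) powr (1 - \<sigma>) * C)" for T :: real
  have "((\<lambda>T. 2 * 2 powr (1 - \<sigma>) * C * T powr ((1 + \<delta>) * (1 - \<sigma>) - 1)) \<longlongrightarrow> 2 * 2 powr (1 - \<sigma>) * C * 0) at_top"
    using assms by (intro tendsto_mult_left tendsto_neg_powr filterlim_ident) auto
  hence "((\<lambda>T. 2 * 2 powr (1 - \<sigma>) * C * T powr ((1 + \<delta>) * (1 - \<sigma>) - 1)) \<longlongrightarrow> 0) at_top" by simp
  moreover have "\<forall>\<^sub>F T in at_top. 2 * 2 powr (1 - \<sigma>) * C * T powr ((1 + \<delta>) * (1 - \<sigma>) - 1) = B T"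
    using eventually_gt_at_top[of 0]
  proof eventually_elim
    case (elim T)
    have "(2 * T powr (1 + \<delta>)) powr (1 - \<sigma>) = 2 powr (1 - \<sigma>) * T powr ((1 + \<delta>) * (1 - \<sigma>))"
      by (subst powr_mult) (auto simp: powr_powr)
    moreover have "T powr ((1 + \<delta>) * (1 - \<sigma>) - 1) = T powr ((1 + \<delta>) * (1 - \<sigma>)) / T"
      using elim by (subst powr_diff) simp
    ultimately show ?case unfolding B_def by (simp only:) simp
  qed
  ultimately have "(B \<longlongrightarrow> 0) at_top" by (rule Lim_transform_eventually)
  hence ev1: "\<forall>\<^sub>F T in at_top. B T < \<epsilon>" using assms by (simp add: order_tendstoD)
  have "filterlim (\<lambda>T. T powr \<delta>) at_top at_top" using assms by real_asymp
  \<comment> \<open>The constant 4 makes Y/2 \<ge> 2 T, which dominates A = T + k as soon as T \<ge>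
    k.\<close>
  hence ev2: "\<forall>\<^sub>F T in at_top. T powr \<delta> \<ge> 4" by (simp add: filterlim_at_top)
  show ?thesis
    using ev1 ev2 eventually_ge_at_top[of "real k"] eventually_ge_at_top[of 2]
  proof eventually_elim
    case (elim T)
    show ?case
    proof
      fix t assume t: "t \<in> {T/2..T}"
      define s where "s = Complex \<sigma> t"
      define X where "X = nat \<lfloor>T powr (1 + \<delta>)\<rfloor>"
      define x where "x = \<alpha> + real X"
      define A where "A = T + real k"
      define Y where "Y = T powr (1 + \<delta>)"
      have Y: "Y \<ge> 4 * T" "Y = T * T powr \<delta>" using elim by (auto simp: Y_def powr_add)
      have X: "real X \<le> Y" "Y < real X + 1" using powr_ge_zero[of T "1 + \<delta>"] unfolding X_def Y_def by linarith+
      have x: "Y / 2 \<le> x" "x \<le> 2 * Y" "1 \<le> x" "A \<le> x"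
        using X Y elim assms unfolding x_def A_def by linarith+
      have sj: "norm (s + of_nat j - 1) \<le> A" if "j \<le> k" for j
      proof -
        have "norm (s + of_nat j - 1) \<le> \<bar>Re (s + of_nat j - 1)\<bar> + \<bar>Im (s + of_nat j - 1)\<bar>" by (rule cmod_le)
        also have "\<dots> = \<bar>\<sigma> + real j - 1\<bar> + t" using t elim by (simp add: s_def)
        also have "\<dots> \<le> A"
        proof -
          have "real j \<le> real k" using that by simp
          thus ?thesis using t assms(1,2) k2 unfolding A_def by auto
        qed
        finally show ?thesis .
      qed
      have "norm (hurwitz_aux k s x) \<le> real k * x powr (1 - Re s) + 2 * A ^ Suc k * x powr (2 - Re s - real k)"
        by (rule norm_hurwitz_aux_le) (use x sj assms elim k2 in \<open>auto simp: s_def A_def\<close>)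
      also have "\<dots> = x powr (1 - \<sigma>) * (real k + 2 * (A ^ Suc k * x powr (1 - real k)))"
      proof -
        have "x powr (2 - \<sigma> - real k) = x powr (1 - \<sigma>) * x powr (1 - real k)"
          unfolding powr_add[symmetric] by (rule arg_cong[where f = "\<lambda>p. x powr p"]) simp
        thus ?thesis by (simp add: s_def algebra_simps)
      qed
      also have "\<dots> \<le> (2 * Y) powr (1 - \<sigma>) * C"
      proof -
        have "A ^ Suc k * x powr (1 - real k) \<le> (2 * T) powr (real k + 1) * (Y / 2) powr (1 - real k)"
        proof (rule mult_mono)
          have "A ^ Suc k \<le> (2 * T) ^ Suc k" using elim by (intro power_mono) (auto simp: A_def)
          also have "\<dots> = (2 * T) powr (real k + 1)" using elim by (subst powr_realpow[symmetric]) (auto simp: add.commute)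
          finally show "A ^ Suc k \<le> (2 * T) powr (real k + 1)" .
          show "x powr (1 - real k) \<le> (Y / 2) powr (1 - real k)"
            using x Y elim k2 by (intro powr_mono2') auto
        qed auto
        also have "\<dots> = 2 powr (2 * real k) * T powr ((real k + 1) + (1 + \<delta>) * (1 - real k))"
        proof -
          have "(2 * T) powr (real k + 1) = 2 powr (real k + 1) * T powr (real k + 1)"
            using elim by (simp add: powr_mult)
          moreover have "(Y / 2) powr (1 - real k) = T powr ((1 + \<delta>) * (1 - real k)) * 2 powr (real k - 1)"
          proof -
            have "(Y / 2) powr (1 - real k) = Y powr (1 - real k) * inverse (2 powr (1 - real k))"
              unfolding divide_inverse[symmetric] by (rule powr_divide)
            also have "inverse (2 powr (1 - real k)) = (2 :: real) powr (real k - 1)"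
              unfolding powr_minus[symmetric] by simp
            also have "Y powr (1 - real k) = T powr ((1 + \<delta>) * (1 - real k))"
              by (simp only: Y_def powr_powr)
            finally show ?thesis .
          qed
          moreover have "2 powr (real k + 1) * 2 powr (real k - 1) = (2 :: real) powr (2 * real k)"
            unfolding powr_add[symmetric] by (rule arg_cong[where f = "\<lambda>p. 2 powr p"]) simp
          ultimately show ?thesis by (simp add: powr_add)
        qed
        also have "\<dots> \<le> 2 powr (2 * real k) * 1"
        proof (intro mult_left_mono)
          have "(real k + 1) + (1 + \<delta>) * (1 - real k) = 2 + \<delta> - real k * \<delta>" by (simp add: algebra_simps)
          hence "T powr ((real k + 1) + (1 + \<delta>) * (1 - real k)) \<le> T powr 0"
            using kd elim by (intro powr_mono) auto
          thus "T powr ((real k + 1) + (1 + \<delta>) * (1 - real k)) \<le> 1" using elim by simp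
        qed auto
        also have "2 powr (2 * real k) * 1 = (4 :: real) ^ k"
        proof -
          have "2 powr (2 * real k) = (2 powr 2) powr real k" by (simp only: powr_powr)
          thus ?thesis by (simp add: powr_realpow)
        qed
        finally have "real k + 2 * (A ^ Suc k * x powr (1 - real k)) \<le> C" by (simp add: C_def)
        moreover have "x powr (1 - \<sigma>) \<le> (2 * Y) powr (1 - \<sigma>)"
          using x assms by (intro powr_mono2) auto
        ultimately show ?thesis using elim by (intro mult_mono) (auto simp: A_def)
      qed
      finally have g: "norm (hurwitz_aux k s x) \<le> (2 * Y) powr (1 - \<sigma>) * C" .
      have s1: "norm (s - 1) \<ge> T / 2" "s \<noteq> 1"
        using abs_Im_le_cmod[of "s - 1"] t elim by (auto simp: s_def complex_eq_iff)
      have "hurwitz_zeta s \<alpha> = hurwitz_aux k s \<alpha> / (s - 1)"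
        using assms k2 s1 by (intro hurwitz_zeta_eq) (auto simp: s_def)
      also have "hurwitz_aux k s \<alpha> = (s - 1) * (\<Sum>n<X. of_real (real n + \<alpha>) powr (- s)) + hurwitz_aux k s x"
        unfolding x_def using assms k2 by (intro hurwitz_aux_plus_nat) (auto simp: s_def)
      finally have "hurwitz_zeta s \<alpha> - (\<Sum>n<X. of_real (real n + \<alpha>) powr (- s)) = hurwitz_aux k s x / (s - 1)"
        using s1 by (simp add: add_divide_distrib)
      hence "norm (hurwitz_zeta s \<alpha> - (\<Sum>n<X. of_real (real n + \<alpha>) powr (- s))) = norm (hurwitz_aux k s x) / norm (s - 1)"
        by (simp add: norm_divide)
      also have "\<dots> \<le> ((2 * Y) powr (1 - \<sigma>) * C) / (T / 2)"
        using g s1 elim by (intro frac_le) (auto simp: C_def)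
      also have "\<dots> = B T" by (simp add: B_def Y_def)
      also have "\<dots> < \<epsilon>" by fact
      finally show "norm (hurwitz_zeta (Complex \<sigma> t) \<alpha> -
        (\<Sum>n<nat \<lfloor>T powr (1 + \<delta>)\<rfloor>. of_real (real n + \<alpha>) powr (- Complex \<sigma> t))) < \<epsilon>"
        by (simp add: s_def X_def)
    qed
  qed
qed

lemma continuous_on_hurwitz_zeta_line:
  assumes "0 < \<sigma>" "\<sigma> < 1" "0 < \<alpha>"
  shows "continuous_on UNIV (\<lambda>t. hurwitz_zeta (Complex \<sigma> t) \<alpha>)"
proof -
  have "continuous_on {s. Re s > 1 - real 1} (\<lambda>s. hurwitz_aux 1 s \<alpha>)"
    using holomorphic_on_hurwitz_aux[OF assms(3)] by (rule holomorphic_on_imp_continuous_on)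
  hence "continuous_on UNIV (\<lambda>t. hurwitz_aux 1 (Complex \<sigma> t) \<alpha>)"
    by (rule continuous_on_compose2) (use assms in \<open>auto simp: Complex_eq intro!: continuous_intros\<close>)
  moreover have "continuous_on UNIV (\<lambda>t. Complex \<sigma> t - 1)"
    by (auto simp: Complex_eq intro!: continuous_intros)
  ultimately have "continuous_on UNIV (\<lambda>t. hurwitz_aux 1 (Complex \<sigma> t) \<alpha> / (Complex \<sigma> t - 1))"
    by (rule continuous_on_divide) (use assms in \<open>auto simp: complex_eq_iff\<close>)
  thus ?thesis
    by (rule continuous_on_eq) (use assms in \<open>auto simp: hurwitz_zeta_eq[of _ 1] complex_eq_iff simp del: hurwitz_aux.simps\<close>)
qed

lemma of_real_powr_Complex:
  assumes "y > 0"
  shows "of_real y powr (- Complex \<sigma> t) = of_real (y powr - \<sigma>) * cis (- (t * ln y))"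
  using assms by (simp add: powr_def Ln_of_real exp_eq_polar complex_eq_iff mult_ac)

section \<open>Mean squares of generalized Dirichlet polynomials\<close>

lemma (in prob_space) integrable_bounded:
  fixes f :: "'a \<Rightarrow> 'b :: {banach, second_countable_topology}"
  assumes "f \<in> borel_measurable M" "\<And>x. norm (f x) \<le> B"
  shows "integrable M f"
  using assms by (intro integrable_const_bound[of _ B]) auto

lemma prob_space_std_normal: "prob_space std_normal_distribution"
  using prob_space_normal_density by simp

lemma gaussian_mean_cis:
  "(CLINT x|std_normal_distribution. cis (a * x)) = of_real (exp (- a\<^sup>2 / 2))"
proof -
  have "(CLINT x|std_normal_distribution. cis (a * x)) = char std_normal_distribution a"
    unfolding char_def by (simp add: cis_conv_exp mult_ac)
  thus ?thesis by (simp add: char_std_normal_distribution)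
qed

text \<open>The correlations of the frequencies are values of a Gaussian, hence positive and
  symmetric. So |a i| |a j| \<le> (|a i|^2 + |a j|^2)/2 reduces the double sum to row sums, as in
  Schur's test, without any separation assumption.\<close>

lemma gaussian_mean_square:
  fixes a :: "'i \<Rightarrow> complex" and l :: "'i \<Rightarrow> real"
  assumes "finite I"
  shows "(LINT x|std_normal_distribution. (norm (\<Sum>i\<in>I. a i * cis (l i * x)))\<^sup>2) \<le>
    (\<Sum>i\<in>I. (norm (a i))\<^sup>2 * (\<Sum>j\<in>I. exp (- (l i - l j)\<^sup>2 / 2)))"
proof -
  interpret prob_space std_normal_distribution by (rule prob_space_std_normal)
  define e where "e i j = exp (- (l i - l j)\<^sup>2 / 2)" for i j
  have e: "e i j = e j i" "e i j \<ge> 0" for i j by (auto simp: e_def power2_commute)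
  have int: "integrable std_normal_distribution (\<lambda>x. c * cis (b * x))" for c b
    by (rule integrable_bounded[of _ "norm c"])
       (auto simp: norm_mult intro!: borel_measurable_continuous_onI continuous_intros)
  have "of_real ((norm (\<Sum>i\<in>I. a i * cis (l i * x)))\<^sup>2) =
      (\<Sum>i\<in>I. \<Sum>j\<in>I. (a i * cnj (a j)) * cis ((l i - l j) * x))" for x
  proof -
    have c: "cis ((l i - l j) * x) = cis (l i * x) * cnj (cis (l j * x))" for i j
      by (simp add: cis_cnj cis_mult left_diff_distrib)
    show ?thesis
      unfolding complex_norm_square cnj_sum sum_product c by (simp add: mult_ac)
  qed
  hence "complex_of_real (LINT x|std_normal_distribution. (norm (\<Sum>i\<in>I. a i * cis (l i * x)))\<^sup>2) =
      (CLINT x|std_normal_distribution. (\<Sum>i\<in>I. \<Sum>j\<in>I. (a i * cnj (a j)) * cis ((l i - l j) * x)))"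
    by (subst integral_complex_of_real[symmetric]) (simp only:)
  also have "\<dots> = (\<Sum>i\<in>I. \<Sum>j\<in>I. CLINT x|std_normal_distribution. (a i * cnj (a j)) * cis ((l i - l j) * x))"
    by (subst Bochner_Integration.integral_sum, intro Bochner_Integration.integrable_sum int,
        rule sum.cong[OF refl], rule Bochner_Integration.integral_sum, rule int)
  also have "\<dots> = (\<Sum>i\<in>I. \<Sum>j\<in>I. (a i * cnj (a j)) * of_real (e i j))"
    unfolding e_def by (simp add: gaussian_mean_cis del: of_real_exp)
  finally have eq: "complex_of_real (LINT x|std_normal_distribution. (norm (\<Sum>i\<in>I. a i * cis (l i * x)))\<^sup>2) = \<dots>" .
  have "(LINT x|std_normal_distribution. (norm (\<Sum>i\<in>I. a i * cis (l i * x)))\<^sup>2) \<le>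
      norm (complex_of_real (LINT x|std_normal_distribution. (norm (\<Sum>i\<in>I. a i * cis (l i * x)))\<^sup>2))"
    by simp
  also have "\<dots> \<le> (\<Sum>i\<in>I. \<Sum>j\<in>I. norm (a i) * norm (a j) * e i j)"
    unfolding eq using e
    by (intro order_trans[OF norm_sum] sum_mono order_trans[OF norm_sum]) (auto simp: norm_mult)
  also have "\<dots> \<le> (\<Sum>i\<in>I. \<Sum>j\<in>I. ((norm (a i))\<^sup>2 + (norm (a j))\<^sup>2) / 2 * e i j)"
  proof (intro sum_mono mult_right_mono)
    show "norm (a i) * norm (a j) \<le> ((norm (a i))\<^sup>2 + (norm (a j))\<^sup>2) / 2" for i j
      using sum_squares_bound[of "norm (a i)" "norm (a j)"] by simp
  qed (use e in auto)
  also have "\<dots> = (\<Sum>i\<in>I. \<Sum>j\<in>I. (norm (a i))\<^sup>2 / 2 * e i j) + (\<Sum>i\<in>I. \<Sum>j\<in>I. (norm (a j))\<^sup>2 / 2 * e i j)"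
    by (simp add: sum.distrib[symmetric] field_simps)
  also have "(\<Sum>i\<in>I. \<Sum>j\<in>I. (norm (a j))\<^sup>2 / 2 * e i j) = (\<Sum>i\<in>I. \<Sum>j\<in>I. (norm (a i))\<^sup>2 / 2 * e i j)"
    by (subst sum.swap) (use e in simp)
  finally show ?thesis by (simp add: e_def sum_distrib_left[symmetric] sum_divide_distrib[symmetric] sum.distrib[symmetric] flip: sum_distrib_left)
qed

text \<open>The reciprocal of the standard normal density at 1, its minimum on [0, 1]. After scaling
  by T, this multiple of the density majorizes the indicator of [T/2, T].\<close>

definition gauss_const :: real where "gauss_const = sqrt (2 * pi) * exp (1 / 2)"

lemma gauss_const_pos: "gauss_const > 0" by (simp add: gauss_const_def)

lemma interval_mean_le_gaussian:
  fixes f :: "real \<Rightarrow> real"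
  assumes "T > 0" "f \<in> borel_measurable borel" "\<And>t. 0 \<le> f t" "\<And>t. f t \<le> B"
  shows "set_lebesgue_integral lborel {T/2..T} f \<le> gauss_const * T * (LINT x|std_normal_distribution. f (T * x))"
proof -
  interpret prob_space std_normal_distribution by (rule prob_space_std_normal)
  have "set_lebesgue_integral lborel {T/2..T} f = (LINT t|lborel. indicator {T/2..T} t * f t)"
    by (simp add: set_lebesgue_integral_def)
  also have "\<dots> = \<bar>T\<bar> *\<^sub>R (LINT x|lborel. indicator {T/2..T} (0 + T * x) * f (0 + T * x))"
    using assms(1) by (intro lborel_integral_real_affine) auto
  finally have 1: "set_lebesgue_integral lborel {T/2..T} f = T * (LINT x|lborel. indicator {T/2..T} (T * x) * f (T * x))"
    using assms(1) by simp
  have fm [measurable]: "(\<lambda>x. f (T * x)) \<in> borel_measurable borel"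
    using assms(2) by measurable
  have intN: "integrable std_normal_distribution (\<lambda>x. f (T * x))"
    by (rule integrable_bounded[of _ B]) (use assms in auto)
  hence int2: "integrable lborel (\<lambda>x. std_normal_density x *\<^sub>R f (T * x))"
    by (subst (asm) integrable_density) auto
  have "(LINT x|lborel. indicator {T/2..T} (T * x) * f (T * x)) \<le>
      (LINT x|lborel. gauss_const * (std_normal_density x *\<^sub>R f (T * x)))"
  proof (rule integral_mono_AE')
    show "integrable lborel (\<lambda>x. gauss_const * (std_normal_density x *\<^sub>R f (T * x)))"
      using int2 by (rule integrable_mult_right)
    have "indicator {T/2..T} (T * x) * f (T * x) \<le> gauss_const * (std_normal_density x *\<^sub>R f (T * x))" for x
    proof (cases "T * x \<in> {T/2..T}")
      case True
      hence "x \<ge> 0" "x \<le> 1" using assms(1) by (auto simp: field_simps zero_le_mult_iff dest: order_trans[of 0 "T/2"])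
      hence "x\<^sup>2 \<le> 1" by (simp add: power_le_one)
      hence "exp (- (1/2)) \<le> exp (- x\<^sup>2 / 2)" by simp
      hence "exp (1/2) * exp (- x\<^sup>2 / 2) \<ge> exp (1/2 :: real) * exp (- (1/2))" by (intro mult_left_mono) auto
      hence "1 \<le> gauss_const * std_normal_density x"
        by (simp add: gauss_const_def std_normal_density_def mult_ac flip: exp_add)
      hence "1 * f (T * x) \<le> (gauss_const * std_normal_density x) * f (T * x)"
        using assms by (intro mult_right_mono) auto
      thus ?thesis using True by simp
    qed (use assms gauss_const_pos in auto)
    thus "AE x in lborel. indicator {T/2..T} (T * x) * f (T * x) \<le> gauss_const * (std_normal_density x *\<^sub>R f (T * x))"
      by simp
    show "AE x in lborel. 0 \<le> gauss_const * (std_normal_density x *\<^sub>R f (T * x))"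
      using assms gauss_const_pos by simp
  qed
  also have "\<dots> = gauss_const * (LINT x|std_normal_distribution. f (T * x))"
    by (subst integral_density) auto
  finally show ?thesis unfolding 1 using assms(1) by (simp add: mult_ac)
qed

lemma interval_mean_square:
  fixes a :: "'i \<Rightarrow> complex" and l :: "'i \<Rightarrow> real"
  assumes "finite I" "T > 0"
  shows "set_lebesgue_integral lborel {T/2..T} (\<lambda>t. (norm (\<Sum>i\<in>I. a i * cis (l i * t)))\<^sup>2) \<le>
    gauss_const * T * (\<Sum>i\<in>I. (norm (a i))\<^sup>2 * (\<Sum>j\<in>I. exp (- (T * (l i - l j))\<^sup>2 / 2)))"
proof -
  have "norm (\<Sum>i\<in>I. a i * cis (l i * t)) \<le> (\<Sum>i\<in>I. norm (a i))" for t
    by (intro order_trans[OF norm_sum] sum_mono) (simp add: norm_mult)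
  hence "set_lebesgue_integral lborel {T/2..T} (\<lambda>t. (norm (\<Sum>i\<in>I. a i * cis (l i * t)))\<^sup>2) \<le>
    gauss_const * T * (LINT x|std_normal_distribution. (norm (\<Sum>i\<in>I. a i * cis (l i * (T * x))))\<^sup>2)"
    by (intro interval_mean_le_gaussian[of _ _ "(\<Sum>i\<in>I. norm (a i))\<^sup>2"] assms power_mono)
       (auto intro!: borel_measurable_continuous_onI continuous_intros)
  also have "\<dots> \<le> gauss_const * T * (\<Sum>i\<in>I. (norm (a i))\<^sup>2 * (\<Sum>j\<in>I. exp (- (T * l i - T * l j)\<^sup>2 / 2)))"
    using gaussian_mean_square[OF assms(1), of a "\<lambda>i. T * l i"] assms(2) gauss_const_pos
    by (intro mult_left_mono) (auto simp: mult_ac)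
  finally show ?thesis by (simp add: right_diff_distrib)
qed

text \<open>Frequencies within h of each other are counted with weight 1, all others contribute at
  most the Gaussian at distance h. With T h a positive power of T this remainder is negligible even
  for polynomially many frequencies.\<close>

lemma interval_mean_square_near:
  fixes a :: "'i \<Rightarrow> complex" and l :: "'i \<Rightarrow> real"
  assumes "finite I" "T > 0" "h > 0"
  shows "set_lebesgue_integral lborel {T/2..T} (\<lambda>t. (norm (\<Sum>i\<in>I. a i * cis (l i * t)))\<^sup>2) \<le>
    gauss_const * T * (\<Sum>i\<in>I. (norm (a i))\<^sup>2 * (real (card {j\<in>I. \<bar>l i - l j\<bar> \<le> h}) + real (card I) * exp (- (T * h)\<^sup>2 / 2)))"
proof -
  have "(\<Sum>j\<in>I. exp (- (T * (l i - l j))\<^sup>2 / 2)) \<le> real (card {j\<in>I. \<bar>l i - l j\<bar> \<le> h}) + real (card I) * exp (- (T * h)\<^sup>2 / 2)" for i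
  proof -
    have "(\<Sum>j\<in>I. exp (- (T * (l i - l j))\<^sup>2 / 2)) \<le>
        (\<Sum>j\<in>I. (if \<bar>l i - l j\<bar> \<le> h then 1 else 0) + exp (- (T * h)\<^sup>2 / 2))"
    proof (rule sum_mono)
      fix j
      show "exp (- (T * (l i - l j))\<^sup>2 / 2) \<le> (if \<bar>l i - l j\<bar> \<le> h then 1 else 0) + exp (- (T * h)\<^sup>2 / 2)"
      proof (cases "\<bar>l i - l j\<bar> \<le> h")
        case False
        hence "(T * h)\<^sup>2 \<le> (T * (l i - l j))\<^sup>2" using assms
          by (auto simp: power_mult_distrib intro!: mult_left_mono) (metis abs_ge_self abs_le_square_iff abs_of_pos less_imp_le not_le)
        thus ?thesis using False by simp
      next
        case True
        have "exp (- (T * (l i - l j))\<^sup>2 / 2) \<le> 1" by simp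
        thus ?thesis using True by (smt (verit) exp_gt_zero)
      qed
    qed
    also have "\<dots> = real (card {j\<in>I. \<bar>l i - l j\<bar> \<le> h}) + real (card I) * exp (- (T * h)\<^sup>2 / 2)"
      using assms by (simp add: sum.distrib sum.If_cases Int_def)
    finally show ?thesis .
  qed
  thus ?thesis using assms gauss_const_pos
    by (intro order_trans[OF interval_mean_square] mult_left_mono sum_mono) auto
qed

lemma prod_cis: "finite A \<Longrightarrow> (\<Prod>x\<in>A. cis (f x)) = cis (\<Sum>x\<in>A. f x)"
  by (induction A rule: finite_induct) (auto simp: cis_mult)

lemma prod_sum_cis:
  fixes B :: "nat \<Rightarrow> nat set"
  assumes "\<And>n. n < N \<Longrightarrow> finite (B n)"
  shows "(\<Prod>n<N. \<Sum>j\<in>B n. b n j * cis (real j * (l n * t))) =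
    (\<Sum>\<kappa>\<in>PiE {..<N} B. (\<Prod>n<N. b n (\<kappa> n)) * cis ((\<Sum>n<N. real (\<kappa> n) * l n) * t))"
  using assms by (subst prod_sum_PiE) (auto simp: prod.distrib prod_cis sum_distrib_right mult.assoc)

lemma set_integrable_interval_continuous:
  fixes f :: "real \<Rightarrow> 'a :: euclidean_space"
  assumes "continuous_on {a..b} f"
  shows "set_integrable lborel {a..b} f"
  using borel_integrable_atLeastAtMost'[OF assms] .

lemma set_integral_sum:
  fixes f :: "'i \<Rightarrow> 'a \<Rightarrow> 'b :: {banach, second_countable_topology}"
  assumes "\<And>i. i \<in> I \<Longrightarrow> set_integrable M A (f i)"
  shows "set_lebesgue_integral M A (\<lambda>x. \<Sum>i\<in>I. f i x) = (\<Sum>i\<in>I. set_lebesgue_integral M A (f i))"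
  using assms unfolding set_lebesgue_integral_def set_integrable_def scaleR_sum_right
  by (rule Bochner_Integration.integral_sum)

text \<open>The Gaussian majorant yields only upper bounds, so here the sharp interval is integrated
  directly. For distinct frequencies each cross term has an antiderivative bounded independently of
  T, and \<open>D\<close> collects these bounds.\<close>

lemma interval_mean_square_lower:
  fixes a :: "'i \<Rightarrow> complex" and l :: "'i \<Rightarrow> real"
  assumes "finite I" "inj_on l I"
  shows "\<exists>D. \<forall>T>0. set_lebesgue_integral lborel {T/2..T} (\<lambda>t. (norm (\<Sum>i\<in>I. a i * cis (l i * t)))\<^sup>2) \<ge>
     T / 2 * (\<Sum>i\<in>I. (norm (a i))\<^sup>2) - D"
proof -
  define g where "g i j t = Re ((a i * cnj (a j)) * cis ((l i - l j) * t))" for i j t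
  define D where "D = (\<Sum>i\<in>I. \<Sum>j\<in>I. if i = j then 0 else 2 * (norm (a i) * norm (a j)) / \<bar>l i - l j\<bar>)"
  have eq: "(norm (\<Sum>i\<in>I. a i * cis (l i * t)))\<^sup>2 = (\<Sum>i\<in>I. \<Sum>j\<in>I. g i j t)" for t
  proof -
    have c: "cis ((l i - l j) * t) = cis (l i * t) * cnj (cis (l j * t))" for i j
      by (simp add: cis_cnj cis_mult left_diff_distrib)
    have "complex_of_real ((norm (\<Sum>i\<in>I. a i * cis (l i * t)))\<^sup>2) =
        (\<Sum>i\<in>I. \<Sum>j\<in>I. (a i * cnj (a j)) * cis ((l i - l j) * t))"
      unfolding complex_norm_square cnj_sum sum_product c by (simp add: mult_ac)
    hence "Re (complex_of_real ((norm (\<Sum>i\<in>I. a i * cis (l i * t)))\<^sup>2)) = (\<Sum>i\<in>I. \<Sum>j\<in>I. g i j t)"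
      by (simp only: Re_sum g_def)
    thus ?thesis by simp
  qed
  have cont: "continuous_on S (g i j)" for i j S
    unfolding g_def by (intro continuous_intros)
  have int: "set_lebesgue_integral lborel {T/2..T} (g i j) \<ge>
      (if i = j then T / 2 * (norm (a i))\<^sup>2 else - (2 * (norm (a i) * norm (a j)) / \<bar>l i - l j\<bar>))"
    if "i \<in> I" "j \<in> I" "T > 0" for i j T
  proof (cases "i = j")
    case True
    have "g i j = (\<lambda>t. (norm (a i))\<^sup>2)" using True by (auto simp: g_def complex_norm_square[symmetric] fun_eq_iff simp flip: of_real_power)
    thus ?thesis using True that by (simp add: set_lebesgue_integral_def)
  next
    case False
    define b where "b = l i - l j"
    have b: "b \<noteq> 0" using False assms that by (auto simp: b_def inj_on_def)
    define G where "G t = Im ((a i * cnj (a j)) * cis (b * t)) / b" for t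
    have "set_lebesgue_integral lborel {T/2..T} (g i j) = integral {T/2..T} (g i j)"
      using cont by (intro set_borel_integral_eq_integral set_integrable_interval_continuous)
    also have "(g i j has_integral (G T - G (T/2))) {T/2..T}"
    proof (rule fundamental_theorem_of_calculus)
      fix t
      have "(G has_real_derivative g i j t) (at t within {T/2..T})"
        unfolding G_def g_def b_def[symmetric] using b
        by (auto intro!: derivative_eq_intros simp: field_simps)
      thus "(G has_vector_derivative g i j t) (at t within {T/2..T})"
        by (simp add: has_real_derivative_iff_has_vector_derivative)
    qed (use that in auto)
    hence "integral {T/2..T} (g i j) = G T - G (T/2)" by (rule integral_unique)
    finally have 1: "set_lebesgue_integral lborel {T/2..T} (g i j) = G T - G (T/2)" .
    have "\<bar>G t\<bar> \<le> norm (a i) * norm (a j) / \<bar>b\<bar>" for t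
      unfolding G_def abs_divide
      by (intro divide_right_mono order_trans[OF abs_Im_le_cmod]) (auto simp: norm_mult)
    from this[of T] this[of "T/2"] have "G T - G (T/2) \<ge> - (2 * (norm (a i) * norm (a j)) / \<bar>b\<bar>)"
      by (simp add: abs_if split: if_splits)
    thus ?thesis using 1 False by (simp add: b_def)
  qed
  show ?thesis
  proof (intro exI[of _ D] allI impI)
    fix T :: real assume T: "T > 0"
    have "T / 2 * (\<Sum>i\<in>I. (norm (a i))\<^sup>2) - D = (\<Sum>i\<in>I. T / 2 * (norm (a i))\<^sup>2 -
        (\<Sum>j\<in>I. if i = j then 0 else 2 * (norm (a i) * norm (a j)) / \<bar>l i - l j\<bar>))"
      by (simp add: D_def sum_subtractf sum_distrib_left)
    also have "\<dots> = (\<Sum>i\<in>I. (\<Sum>j\<in>I. if i = j then T / 2 * (norm (a i))\<^sup>2 else - (2 * (norm (a i) * norm (a j)) / \<bar>l i - l j\<bar>)))"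
    proof (rule sum.cong[OF refl])
      fix i assume i: "i \<in> I"
      have "T / 2 * (norm (a i))\<^sup>2 = (\<Sum>j\<in>I. if i = j then T / 2 * (norm (a i))\<^sup>2 else 0)"
        using i assms by simp
      hence "T / 2 * (norm (a i))\<^sup>2 - (\<Sum>j\<in>I. if i = j then 0 else 2 * (norm (a i) * norm (a j)) / \<bar>l i - l j\<bar>) =
        (\<Sum>j\<in>I. if i = j then T / 2 * (norm (a i))\<^sup>2 else 0) -
        (\<Sum>j\<in>I. if i = j then 0 else 2 * (norm (a i) * norm (a j)) / \<bar>l i - l j\<bar>)"
        by (rule arg_cong[where f = "\<lambda>x. x - _"])
      also have "\<dots> = (\<Sum>j\<in>I. if i = j then T / 2 * (norm (a i))\<^sup>2 else - (2 * (norm (a i) * norm (a j)) / \<bar>l i - l j\<bar>))"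
        by (subst sum_subtractf[symmetric]) (intro sum.cong; simp)
      finally show "T / 2 * (norm (a i))\<^sup>2 - (\<Sum>j\<in>I. if i = j then 0 else 2 * (norm (a i) * norm (a j)) / \<bar>l i - l j\<bar>) =
        (\<Sum>j\<in>I. if i = j then T / 2 * (norm (a i))\<^sup>2 else - (2 * (norm (a i) * norm (a j)) / \<bar>l i - l j\<bar>))" .
    qed
    also have "\<dots> \<le> (\<Sum>i\<in>I. \<Sum>j\<in>I. set_lebesgue_integral lborel {T/2..T} (g i j))"
      using int T by (intro sum_mono) auto
    also have "\<dots> = set_lebesgue_integral lborel {T/2..T} (\<lambda>t. \<Sum>i\<in>I. \<Sum>j\<in>I. g i j t)"
    proof -
      have "set_lebesgue_integral lborel {T/2..T} (\<lambda>t. \<Sum>i\<in>I. \<Sum>j\<in>I. g i j t) =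
          (\<Sum>i\<in>I. set_lebesgue_integral lborel {T/2..T} (\<lambda>t. \<Sum>j\<in>I. g i j t))"
        by (rule set_integral_sum) (use assms cont in \<open>auto intro!: set_integrable_interval_continuous continuous_on_sum\<close>)
      also have "\<dots> = (\<Sum>i\<in>I. \<Sum>j\<in>I. set_lebesgue_integral lborel {T/2..T} (g i j))"
        by (intro sum.cong[OF refl] set_integral_sum) (use assms cont in \<open>auto intro!: set_integrable_interval_continuous\<close>)
      finally show ?thesis by simp
    qed
    finally show "set_lebesgue_integral lborel {T/2..T} (\<lambda>t. (norm (\<Sum>i\<in>I. a i * cis (l i * t)))\<^sup>2) \<ge>
       T / 2 * (\<Sum>i\<in>I. (norm (a i))\<^sup>2) - D" by (simp add: eq)
  qed
qed

section \<open>Prescribing the phases\<close>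

text \<open>The n-th vector, of length \<open>l n\<close>, is pointed along the current remainder,
  so the norm r of the remainder becomes |r - l n|.\<close>

primrec greedy_remainder :: "(nat \<Rightarrow> real) \<Rightarrow> complex \<Rightarrow> nat \<Rightarrow> complex" where
  "greedy_remainder l z 0 = z"
| "greedy_remainder l z (Suc n) = greedy_remainder l z n - of_real (l n) * cis (Arg (greedy_remainder l z n))"

lemma greedy_remainder_eq:
  "greedy_remainder l z N = z - (\<Sum>n<N. of_real (l n) * cis (Arg (greedy_remainder l z n)))"
  by (induction N) auto

lemma norm_greedy_remainder_Suc:
  "norm (greedy_remainder l z (Suc n)) = \<bar>norm (greedy_remainder l z n) - l n\<bar>"
proof -
  have "w - of_real a * cis (Arg w) = of_real (norm w - a) * cis (Arg w)" for w a
    using rcis_cmod_Arg[of w] by (simp add: rcis_def algebra_simps)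
  thus ?thesis by (simp add: norm_mult del: of_real_diff)
qed

text \<open>The lengths tend to 0 but have divergent sum because \<sigma> < 1. Since |r - l| \<le>
  max (r - l) l, the greedy remainder decreases until it is below \<eta> and then stays there.
  Bounding the lengths by (n+1)^(-\<sigma>) from below, and by n^(-\<sigma>) and c^(-\<sigma>) from
  above, makes the threshold independent of \<alpha>.\<close>

lemma powr_phases_exist:
  fixes \<sigma> c \<eta> :: real and z :: complex
  assumes "0 < \<sigma>" "\<sigma> < 1" "0 < c" "0 < \<eta>"
  shows "\<exists>N\<^sub>0. \<forall>N\<ge>N\<^sub>0. \<forall>\<alpha>. c < \<alpha> \<and> \<alpha> < 1 \<longrightarrow>
    (\<exists>\<theta>. norm ((\<Sum>n<N. of_real ((real n + \<alpha>) powr - \<sigma>) * cis (\<theta> n)) - z) \<le> \<eta>)"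
proof -
  have "((\<lambda>n. real n powr - \<sigma>) \<longlongrightarrow> 0) sequentially"
    using assms by (intro tendsto_neg_powr filterlim_real_sequentially) auto
  hence "\<forall>\<^sub>F n in sequentially. real n powr - \<sigma> < \<eta>" using assms by (simp add: order_tendstoD)
  then obtain n0 where n0: "\<And>n. n \<ge> n0 \<Longrightarrow> real n powr - \<sigma> < \<eta>"
    by (auto simp: eventually_sequentially)
  \<comment> \<open>The successor excludes index 0, where \<open>0 powr - \<sigma> = 0\<close> is no
    upper bound for the length.\<close>
  define n1 where "n1 = Suc n0"
  define B where "B = norm z + c powr - \<sigma>"
  have "\<not> summable (\<lambda>i. real (i + Suc n1) powr - \<sigma>)"
    using assms by (subst summable_iff_shift[of "\<lambda>i. real i powr - \<sigma>"]) (simp add: summable_real_powr_iff)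
  then obtain m0 where m0: "(\<Sum>i<m0. real (i + Suc n1) powr - \<sigma>) > B"
    using summableI_nonneg_bounded[of "\<lambda>i. real (i + Suc n1) powr - \<sigma>" B] by (auto simp: not_le[symmetric])
  show ?thesis
  proof (intro exI[of _ "n1 + m0"] allI impI)
    fix N \<alpha> assume N: "n1 + m0 \<le> N" and \<alpha>: "c < \<alpha> \<and> \<alpha> < 1"
    define l where "l n = (real n + \<alpha>) powr - \<sigma>" for n
    define r where "r = greedy_remainder l z"
    have lc: "l n \<le> c powr - \<sigma>" for n
      unfolding l_def using assms \<alpha> by (intro powr_mono2') auto
    have l0: "l n > 0" for n unfolding l_def using assms \<alpha> by (simp add: add_nonneg_pos)
    have l\<eta>: "l n \<le> \<eta>" if "n \<ge> n1" for n
    proof -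
      have "l n \<le> real n powr - \<sigma>" unfolding l_def using assms \<alpha> that by (intro powr_mono2') (auto simp: n1_def)
      thus ?thesis using n0[of n] that by (simp add: n1_def)
    qed
    have ll: "l n \<ge> real (Suc n) powr - \<sigma>" for n
      unfolding l_def using assms \<alpha> by (intro powr_mono2') auto
    have step: "norm (r (Suc n)) \<le> max (norm (r n) - l n) (l n)" for n
      unfolding r_def norm_greedy_remainder_Suc using l0[of n] by (auto simp: abs_if)
    have rB: "norm (r n) \<le> B" for n
    proof (induction n)
      case (Suc n)
      thus ?case using step[of n] l0[of n] lc[of n] norm_ge_zero[of z] unfolding B_def
        by linarith
    qed (use assms in \<open>simp add: r_def B_def\<close>)
    have "norm (r (n1 + m)) \<le> max (B - (\<Sum>i<m. real (i + Suc n1) powr - \<sigma>)) \<eta>" for m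
    proof (induction m)
      case 0
      thus ?case using rB[of n1] by simp
    next
      case (Suc m)
      have "norm (r (n1 + Suc m)) \<le> max (norm (r (n1 + m)) - l (n1 + m)) (l (n1 + m))"
        using step[of "n1 + m"] by simp
      moreover have "l (n1 + m) \<ge> real (m + Suc n1) powr - \<sigma>"
        using ll[of "n1 + m"] by (simp add: add_ac)
      ultimately show ?case using Suc l\<eta>[of "n1 + m"] l0[of "n1 + m"] by (simp del: of_nat_add of_nat_Suc)
    qed
    from this[of "N - n1"] have "norm (r N) \<le> max (B - (\<Sum>i<N - n1. real (i + Suc n1) powr - \<sigma>)) \<eta>"
      using N by simp
    moreover have "(\<Sum>i<N - n1. real (i + Suc n1) powr - \<sigma>) \<ge> (\<Sum>i<m0. real (i + Suc n1) powr - \<sigma>)"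
      using N by (intro sum_mono2) auto
    ultimately have "norm (r N) \<le> \<eta>" using m0 assms by linarith
    thus "\<exists>\<theta>. norm ((\<Sum>n<N. of_real ((real n + \<alpha>) powr - \<sigma>) * cis (\<theta> n)) - z) \<le> \<eta>"
      unfolding r_def greedy_remainder_eq[of l z N] l_def[symmetric]
      by (subst (asm) norm_minus_commute) (rule exI)
  qed
qed

section \<open>Multiplicative relations between the shifted integers\<close>

definition shifted_monomial :: "nat \<Rightarrow> (nat \<Rightarrow> nat) \<Rightarrow> 'a :: comm_ring_1 \<Rightarrow> 'a" where
  "shifted_monomial N \<kappa> \<alpha> = (\<Prod>n<N. (of_nat n + \<alpha>) ^ \<kappa> n)"

text \<open>A pair is recovered from the root multiplicities of its polynomial: -i has multiplicity
  \<open>\<kappa> i\<close> for i < N, and because m \<ge> N the remaining root -m lies apart from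
  these. Distinct pairs thus give distinct polynomials, and each of the finitely many differences
  has finitely many roots.\<close>

lemma finite_multiplicative_relations:
  "finite {\<alpha> :: real. \<not> inj_on (\<lambda>(\<kappa>, m). shifted_monomial N \<kappa> \<alpha> * (real m + \<alpha>))
     (({..<N} \<rightarrow>\<^sub>E {..K}) \<times> {N..M})}" (is "finite ?S")
proof -
  define I where "I = ({..<N} \<rightarrow>\<^sub>E {..K}) \<times> {N..M}"
  define Q :: "(nat \<Rightarrow> nat) \<times> nat \<Rightarrow> real poly" where
    "Q = (\<lambda>(\<kappa>, m). (\<Prod>n<N. [:real n, 1:] ^ \<kappa> n) * [:real m, 1:])"
  have poly_Q: "poly (Q (\<kappa>, m)) \<alpha> = shifted_monomial N \<kappa> \<alpha> * (real m + \<alpha>)" for \<kappa> m \<alpha>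
    by (simp add: Q_def shifted_monomial_def poly_prod algebra_simps)
  have count: "count (proots (Q (\<kappa>, m))) (- real i) = (if i < N then \<kappa> i else if i = m then 1 else 0)"
    if "m \<ge> N" for \<kappa> m i
  proof -
    have nz: "(\<Prod>n<N. [:real n, 1:] ^ \<kappa> n) \<noteq> 0" by simp
    have "proots (Q (\<kappa>, m)) = (\<Sum>n<N. repeat_mset (\<kappa> n) {#- real n#}) + {#- real m#}"
      unfolding Q_def prod.case using nz
      by (subst proots_mult) (simp_all add: proots_prod proots_power del: prod_zero_iff mult_pCons_right mult_pCons_left)
    hence "count (proots (Q (\<kappa>, m))) (- real i) = (\<Sum>n<N. if n = i then \<kappa> n else 0) + (if i = m then 1 else 0)"
      by (simp add: count_sum)
    thus ?thesis using that by (auto simp: sum.delta)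
  qed
  have inj: "p = q" if "p \<in> I" "q \<in> I" "Q p = Q q" for p q
  proof -
    obtain \<kappa> m \<kappa>' m' where pq: "p = (\<kappa>, m)" "q = (\<kappa>', m')" by (cases p, cases q)
    have m: "m \<ge> N" "m' \<ge> N" and k: "\<kappa> \<in> {..<N} \<rightarrow>\<^sub>E {..K}" "\<kappa>' \<in> {..<N} \<rightarrow>\<^sub>E {..K}"
      using that pq by (auto simp: I_def)
    have eq: "(if i < N then \<kappa> i else if i = m then 1 else 0) = (if i < N then \<kappa>' i else if i = m' then 1 else 0)" for i
      using count[OF m(1), of \<kappa> i] count[OF m(2), of \<kappa>' i] that(3) pq by simp
    have "\<kappa> i = \<kappa>' i" if "i \<in> {..<N}" for i using eq[of i] that by simp
    hence "\<kappa> = \<kappa>'" using k by (intro PiE_ext)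
    moreover have "m = m'" using eq[of m] m by (auto split: if_splits)
    ultimately show ?thesis by (simp add: pq)
  qed
  have fin: "finite I" by (auto simp: I_def intro!: finite_PiE)
  have "?S \<subseteq> (\<Union>(p, q) \<in> {(p, q). p \<in> I \<and> q \<in> I \<and> p \<noteq> q}. {\<alpha>. poly (Q p - Q q) \<alpha> = 0})"
    unfolding inj_on_def I_def[symmetric] using poly_Q by (fastforce simp del: poly_Q)
  moreover have "finite \<dots>"
  proof (rule finite_UN_I)
    show "finite {(p, q). p \<in> I \<and> q \<in> I \<and> p \<noteq> q}"
      by (rule finite_subset[of _ "I \<times> I"]) (use fin in auto)
    show "finite (case pq of (p, q) \<Rightarrow> {\<alpha>. poly (Q p - Q q) \<alpha> = 0})"
      if "pq \<in> {(p, q). p \<in> I \<and> q \<in> I \<and> p \<noteq> q}" for pq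
    proof -
      obtain p q where pq: "pq = (p, q)" by (cases pq)
      hence "Q p - Q q \<noteq> 0" using that inj[of p q] by auto
      thus ?thesis unfolding pq prod.case by (rule poly_roots_finite)
    qed
  qed
  ultimately show ?thesis by (rule finite_subset)
qed

section \<open>Tails, gaps and separated frequencies\<close>

lemma powr_tail_small:
  assumes "p > 1" "\<eta> > 0"
  shows "\<exists>N\<^sub>0. \<forall>N\<ge>N\<^sub>0. \<forall>X. (\<Sum>m\<in>{N..<X}. real m powr - p) \<le> \<eta>"
proof -
  have "summable (\<lambda>m. real m powr - p)" using assms by (simp add: summable_real_powr_iff)
  then obtain N0 where "\<And>m n. m \<ge> N0 \<Longrightarrow> norm (\<Sum>i\<in>{m..<n}. real i powr - p) < \<eta>"
    using assms(2) unfolding summable_Cauchy by blast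
  thus ?thesis by (intro exI[of _ N0]) (fastforce simp: abs_less_iff intro: less_imp_le)
qed

lemma card_le_of_spread:
  fixes S :: "nat set"
  assumes "finite S" "\<And>x y. x \<in> S \<Longrightarrow> y \<in> S \<Longrightarrow> real x - real y \<le> L" "L \<ge> 0"
  shows "real (card S) \<le> 1 + L"
proof (cases "S = {}")
  case False
  have "S \<subseteq> {Min S..Max S}" using assms(1) by auto
  hence "card S \<le> Suc (Max S) - Min S" using card_mono[of "{Min S..Max S}" S] by simp
  moreover have "real (Max S) - real (Min S) \<le> L" using assms False by (intro assms(2)) auto
  moreover have "Min S \<le> Max S" using assms False by auto
  ultimately show ?thesis by linarith
qed (use assms in auto)

lemma finite_gap:
  fixes l :: "'i \<Rightarrow> real"
  assumes "finite I" "inj_on l I"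
  shows "\<exists>h>0. \<forall>i\<in>I. \<forall>j\<in>I. \<bar>l i - l j\<bar> \<le> h \<longrightarrow> i = j"
proof -
  \<comment> \<open>The element 1 keeps the set nonempty when there is no pair of distinct
    indices.\<close>
  define G where "G = insert 1 ((\<lambda>(i, j). \<bar>l i - l j\<bar>) ` {(i, j) \<in> I \<times> I. i \<noteq> j})"
  have fin: "finite G" unfolding G_def
    by (intro finite.insertI finite_imageI finite_subset[OF _ finite_cartesian_product[OF assms(1) assms(1)]]) auto
  have pos: "\<And>g. g \<in> G \<Longrightarrow> g > 0" using assms(2) by (auto simp: G_def inj_on_def)
  have "Min G > 0" using fin pos by (subst Min_gr_iff) (auto simp: G_def)
  moreover have "i = j" if "i \<in> I" "j \<in> I" "\<bar>l i - l j\<bar> \<le> Min G / 2" for i j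
  proof (rule ccontr)
    assume "i \<noteq> j"
    hence "Min G \<le> \<bar>l i - l j\<bar>" using that fin by (intro Min_le) (auto simp: G_def)
    thus False using that \<open>Min G > 0\<close> by linarith
  qed
  ultimately show ?thesis by (intro exI[of _ "Min G / 2"]) auto
qed

text \<open>A finite set of distinct frequencies has a positive gap, so for large T only the
  diagonal survives; the factor 2 is 1 for the diagonal plus at most 1 for the Gaussian
  remainder.\<close>

lemma interval_mean_square_inj:
  fixes a :: "'i \<Rightarrow> complex" and l :: "'i \<Rightarrow> real"
  assumes "finite I" "inj_on l I"
  shows "\<forall>\<^sub>F T in at_top. set_lebesgue_integral lborel {T/2..T} (\<lambda>t. (norm (\<Sum>i\<in>I. a i * cis (l i * t)))\<^sup>2) \<le>
    gauss_const * T * (2 * (\<Sum>i\<in>I. (norm (a i))\<^sup>2))"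
proof -
  obtain h where h: "h > 0" "\<And>i j. i \<in> I \<Longrightarrow> j \<in> I \<Longrightarrow> \<bar>l i - l j\<bar> \<le> h \<Longrightarrow> i = j"
    using finite_gap[OF assms] by blast
  have "((\<lambda>T. real (card I) * exp (- (T * h)\<^sup>2 / 2)) \<longlongrightarrow> 0) at_top"
    using h(1) by real_asymp
  hence "\<forall>\<^sub>F T in at_top. real (card I) * exp (- (T * h)\<^sup>2 / 2) < 1" by (simp add: order_tendstoD)
  with eventually_gt_at_top[of 0] show ?thesis
  proof eventually_elim
    case (elim T)
    have "real (card {j\<in>I. \<bar>l i - l j\<bar> \<le> h}) \<le> 1" if "i \<in> I" for i
    proof -
      have "{j\<in>I. \<bar>l i - l j\<bar> \<le> h} \<subseteq> {i}" using h(2) that by blast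
      from card_mono[OF _ this] show ?thesis by simp
    qed
    hence "(\<Sum>i\<in>I. (norm (a i))\<^sup>2 * (real (card {j\<in>I. \<bar>l i - l j\<bar> \<le> h}) + real (card I) * exp (- (T * h)\<^sup>2 / 2))) \<le>
        (\<Sum>i\<in>I. (norm (a i))\<^sup>2 * 2)"
      using elim by (intro sum_mono mult_left_mono) fastforce+
    also have "\<dots> = 2 * (\<Sum>i\<in>I. (norm (a i))\<^sup>2)" by (simp add: sum_distrib_left mult.commute)
    finally show ?case
      using elim h(1) assms(1) gauss_const_pos
      by (intro order_trans[OF interval_mean_square_near[of I T h]] mult_left_mono) auto
  qed
qed

text \<open>The squared modulus is K^N times a product of Fejer kernels of order K, centred at the
  phases \<theta>. Unlike an indicator function it is a trigonometric polynomial with finitely many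
  frequencies, so only bounded relations matter.\<close>

definition phase_poly :: "nat \<Rightarrow> nat \<Rightarrow> (nat \<Rightarrow> real) \<Rightarrow> (nat \<Rightarrow> real) \<Rightarrow> real \<Rightarrow> complex" where
  "phase_poly N K l \<theta> t = (\<Prod>n<N. \<Sum>j<K. cis (real j * (l n * t - \<theta> n)))"

lemma continuous_on_phase_poly: "continuous_on S (phase_poly N K l \<theta>)"
  unfolding phase_poly_def by (intro continuous_intros)

lemma norm_phase_poly_le: "norm (phase_poly N K l \<theta> t) \<le> real (K ^ N)"
proof -
  have "norm (\<Sum>j<K. cis (real j * (l n * t - \<theta> n))) \<le> real K" for n
    by (rule order_trans[OF norm_sum]) simp
  hence "norm (phase_poly N K l \<theta> t) \<le> (\<Prod>n<N. real K)"
    unfolding phase_poly_def prod_norm[symmetric] by (intro prod_mono) auto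
  thus ?thesis by simp
qed

definition phase_freq :: "nat \<Rightarrow> (nat \<Rightarrow> real) \<Rightarrow> (nat \<Rightarrow> nat) \<Rightarrow> real" where
  "phase_freq N l \<kappa> = (\<Sum>n<N. real (\<kappa> n) * l n)"

definition phase_coeff :: "nat \<Rightarrow> (nat \<Rightarrow> real) \<Rightarrow> (nat \<Rightarrow> nat) \<Rightarrow> complex" where
  "phase_coeff N \<theta> \<kappa> = (\<Prod>n<N. cis (- (real (\<kappa> n) * \<theta> n)))"

lemma norm_phase_coeff [simp]: "norm (phase_coeff N \<theta> \<kappa>) = 1"
  unfolding phase_coeff_def prod_norm[symmetric] by simp

lemma phase_poly_expand:
  "phase_poly N K l \<theta> t = (\<Sum>\<kappa>\<in>{..<N} \<rightarrow>\<^sub>E {..<K}. phase_coeff N \<theta> \<kappa> * cis (phase_freq N l \<kappa> * t))"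
proof -
  have "phase_poly N K l \<theta> t = (\<Prod>n<N. \<Sum>j<K. cis (- (real j * \<theta> n)) * cis (real j * (l n * t)))"
    unfolding phase_poly_def by (simp add: cis_mult algebra_simps)
  also have "\<dots> = (\<Sum>\<kappa>\<in>{..<N} \<rightarrow>\<^sub>E {..<K}. phase_coeff N \<theta> \<kappa> * cis (phase_freq N l \<kappa> * t))"
    unfolding phase_coeff_def phase_freq_def by (rule prod_sum_cis) simp
  finally show ?thesis .
qed

text \<open>
  Multiplication by \<open>cis (l n * t) - cis (\<theta> n)\<close> telescopes the \<open>n\<close>-th geometric sum, leaving two terms out
  of \<open>K\<close>; this is why \<open>phase_poly\<close> concentrates on the prescribed phases.
\<close>

lemma phase_poly_mult_diff:
  assumes "n < N" "K > 0"
  shows "\<exists>a. (\<forall>\<kappa>. norm (a \<kappa>) = 1) \<and> (\<forall>t. phase_poly N K l \<theta> t * (cis (l n * t) - cis (\<theta> n)) =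
    (\<Sum>\<kappa>\<in>PiE {..<N} (\<lambda>m. if m = n then {0, K} else {..<K}). a \<kappa> * cis (phase_freq N l \<kappa> * t)))"
proof -
  define B where "B m = (if m = n then {0, K} else {..<K})" for m
  \<comment> \<open>With \<open>cis (\<theta> n)\<close> pulled out, the n-th factor becomes cis (K
    x) - 1 for x = l n * t - \<theta> n; this explains the exponents 0 and K and the sign -1 at
    exponent 0.\<close>
  define b where "b m j = (if m = n \<and> j = 0 then - 1 else 1) * cis (- (real j * \<theta> m))" for m j
  have geo: "(cis x - 1) * (\<Sum>j<K. cis (real j * x)) = cis (real K * x) - 1" for x
  proof -
    have "cis (real j * x) = cis x ^ j" for j by (simp add: Complex.DeMoivre)
    thus ?thesis using power_diff_1_eq[of "cis x" K] by simp
  qed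
  have "phase_poly N K l \<theta> t * (cis (l n * t) - cis (\<theta> n)) =
      cis (\<theta> n) * (\<Sum>\<kappa>\<in>PiE {..<N} B. (\<Prod>m<N. b m (\<kappa> m)) * cis (phase_freq N l \<kappa> * t))" for t
  proof -
    define F where "F m = (\<Sum>j<K. cis (real j * (l m * t - \<theta> m)))" for m
    have Fb: "(\<Sum>j\<in>B m. b m j * cis (real j * (l m * t))) = (if m = n then (cis (l n * t - \<theta> n) - 1) * F n else F m)" for m
    proof (cases "m = n")
      case True
      have "(\<Sum>j\<in>B m. b m j * cis (real j * (l m * t))) = cis (real K * (l n * t - \<theta> n)) - 1"
        using True assms by (simp add: B_def b_def cis_mult algebra_simps)
      thus ?thesis using True geo[of "l n * t - \<theta> n"] by (simp add: F_def)
    next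
      case False
      thus ?thesis by (simp add: B_def b_def F_def cis_mult algebra_simps)
    qed
    have "(\<Sum>\<kappa>\<in>PiE {..<N} B. (\<Prod>m<N. b m (\<kappa> m)) * cis (phase_freq N l \<kappa> * t)) =
        (\<Prod>m<N. \<Sum>j\<in>B m. b m j * cis (real j * (l m * t)))"
      unfolding phase_freq_def by (rule prod_sum_cis[symmetric]) (simp add: B_def)
    also have "\<dots> = (cis (l n * t - \<theta> n) - 1) * F n * (\<Prod>m\<in>{..<N} - {n}. F m)"
      unfolding Fb using assms by (subst prod.remove[of _ n]) (auto intro!: prod.cong)
    also have "\<dots> = (cis (l n * t - \<theta> n) - 1) * (\<Prod>m<N. F m)"
      using assms by (subst (2) prod.remove[of _ n]) auto
    also have "cis (\<theta> n) * \<dots> = (cis (\<theta> n) * cis (l n * t - \<theta> n) - cis (\<theta> n)) * (\<Prod>m<N. F m)"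
      by (simp add: algebra_simps)
    finally show ?thesis by (simp add: cis_mult phase_poly_def F_def mult.commute)
  qed
  moreover have "norm (cis (\<theta> n) * (\<Prod>m<N. b m (\<kappa> m))) = 1" for \<kappa>
    unfolding norm_mult prod_norm[symmetric] b_def by (auto intro!: prod.neutral)
  ultimately show ?thesis
    unfolding B_def
    by (intro exI[of _ "\<lambda>\<kappa>. cis (\<theta> n) * (\<Prod>m<N. b m (\<kappa> m))"]) (simp add: sum_distrib_left mult.assoc)
qed

lemma phase_poly_mean_lower:
  assumes "inj_on (phase_freq N l) ({..<N} \<rightarrow>\<^sub>E {..K})"
  shows "\<exists>D. \<forall>T>0. set_lebesgue_integral lborel {T/2..T} (\<lambda>t. (norm (phase_poly N K l \<theta> t))\<^sup>2) \<ge> T / 2 * real (K ^ N) - D"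
proof -
  have "inj_on (phase_freq N l) ({..<N} \<rightarrow>\<^sub>E {..<K})"
    using assms by (rule inj_on_subset) (intro PiE_mono, auto)
  from interval_mean_square_lower[OF _ this, of "phase_coeff N \<theta>"]
  show ?thesis by (simp add: phase_poly_expand[symmetric] card_PiE finite_PiE)
qed

text \<open>Telescoping leaves 2 K^(N-1) frequencies where the full polynomial has K^N. Compared
  with \<open>phase_poly_mean_lower\<close>, the weighted mean of the squared phase error is
  therefore of order 1/K. The exponent K itself occurs, hence injectivity on
  \<open>{..K}\<close>.\<close>

lemma phase_poly_diff_mean:
  assumes "inj_on (phase_freq N l) ({..<N} \<rightarrow>\<^sub>E {..K})" "n < N" "K > 0"
  shows "\<forall>\<^sub>F T in at_top. set_lebesgue_integral lborel {T/2..T}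
    (\<lambda>t. (norm (phase_poly N K l \<theta> t * (cis (l n * t) - cis (\<theta> n))))\<^sup>2) \<le> gauss_const * T * (4 * real (K ^ (N - 1)))"
proof -
  let ?B = "\<lambda>m. if m = n then {0, K} else {..<K}"
  obtain a where *: "(\<forall>\<kappa>. norm (a \<kappa>) = 1) \<and> (\<forall>t. phase_poly N K l \<theta> t * (cis (l n * t) - cis (\<theta> n)) =
    (\<Sum>\<kappa>\<in>PiE {..<N} ?B. a \<kappa> * cis (phase_freq N l \<kappa> * t)))"
    using phase_poly_mult_diff[OF assms(2,3), of l \<theta>] by (rule exE)
  note a = conjunct1[OF *, rule_format] conjunct2[OF *, rule_format]
  have inj: "inj_on (phase_freq N l) (PiE {..<N} ?B)"
    by (rule inj_on_subset[OF assms(1)], rule PiE_mono) auto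
  have "card (PiE {..<N} ?B) = (\<Prod>m<N. card (?B m))" by (simp add: card_PiE)
  also have "\<dots> = card (?B n) * (\<Prod>m\<in>{..<N} - {n}. card (?B m))"
    using assms by (intro prod.remove) auto
  also have "(\<Prod>m\<in>{..<N} - {n}. card (?B m)) = (\<Prod>m\<in>{..<N} - {n}. K)" by (intro prod.cong) auto
  also have "card (?B n) * \<dots> = 2 * K ^ (N - 1)" using assms by simp
  finally have card: "card (PiE {..<N} ?B) = 2 * K ^ (N - 1)" .
  have "finite (PiE {..<N} ?B)" by (intro finite_PiE) auto
  from interval_mean_square_inj[OF this inj, of a]
  have "\<forall>\<^sub>F T in at_top. set_lebesgue_integral lborel {T/2..T}
    (\<lambda>t. (norm (phase_poly N K l \<theta> t * (cis (l n * t) - cis (\<theta> n))))\<^sup>2) \<le>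
      gauss_const * T * (2 * (\<Sum>\<kappa>\<in>PiE {..<N} ?B. (norm (a \<kappa>))\<^sup>2))"
    by (simp only: a(2))
  moreover have "(\<Sum>\<kappa>\<in>PiE {..<N} ?B. (norm (a \<kappa>))\<^sup>2) = real (2 * K ^ (N - 1))"
    by (simp only: a(1) card[symmetric]) simp
  ultimately show ?thesis by simp
qed

section \<open>The tail\<close>

text \<open>The bounds do not involve \<alpha>, so the ratio of any two monomials has a bound that
  can be fixed before \<alpha>.\<close>

lemma shifted_monomial_bounds:
  fixes \<alpha> c :: real
  assumes "0 < c" "c < \<alpha>" "\<alpha> < 1" "\<kappa> \<in> {..<N} \<rightarrow>\<^sub>E {..K}"
  shows "(c ^ K) ^ N \<le> shifted_monomial N \<kappa> \<alpha>" "shifted_monomial N \<kappa> \<alpha> \<le> (real N ^ K) ^ N"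
proof -
  have k: "\<kappa> n \<le> K" if "n < N" for n using assms(4) that by (auto simp: PiE_iff)
  have lower: "c ^ K \<le> (real n + \<alpha>) ^ \<kappa> n" if "n < N" for n
  proof -
    have "c ^ K \<le> c ^ \<kappa> n" using assms k[OF that] by (intro power_decreasing) auto
    also have "\<dots> \<le> (real n + \<alpha>) ^ \<kappa> n" using assms by (intro power_mono) auto
    finally show ?thesis .
  qed
  have upper: "(real n + \<alpha>) ^ \<kappa> n \<le> real N ^ K" if "n < N" for n
  proof -
    have "real n + 1 \<le> real N" using that by linarith
    hence "(real n + \<alpha>) ^ \<kappa> n \<le> real N ^ \<kappa> n" using assms by (intro power_mono) auto
    also have "\<dots> \<le> real N ^ K" using k[OF that] that by (intro power_increasing) auto
    finally show ?thesis .
  qed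
  have "(\<Prod>n<N. c ^ K) \<le> shifted_monomial N \<kappa> \<alpha>"
    unfolding shifted_monomial_def using lower assms by (intro prod_mono) auto
  thus "(c ^ K) ^ N \<le> shifted_monomial N \<kappa> \<alpha>" by simp
  have "shifted_monomial N \<kappa> \<alpha> \<le> (\<Prod>n<N. real N ^ K)"
    unfolding shifted_monomial_def using upper assms by (intro prod_mono) auto
  thus "shifted_monomial N \<kappa> \<alpha> \<le> (real N ^ K) ^ N" by simp
qed

lemma phase_freq_ln:
  fixes \<alpha> :: real
  assumes "\<alpha> > 0"
  shows "phase_freq N (\<lambda>n. - ln (real n + \<alpha>)) \<kappa> = - ln (shifted_monomial N \<kappa> \<alpha>)"
  unfolding phase_freq_def shifted_monomial_def using assms
  by (subst ln_prod) (auto simp: ln_realpow sum_negf add_nonneg_pos)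

text \<open>Neighbouring frequencies have comparable m: the constant 4 R is the product of exp h
  \<le> 2, the ratio R of the monomials, and m + \<alpha> \<le> 2 m.\<close>

lemma near_frequency_bound:
  fixes \<alpha> q q' R h :: real
  assumes "0 < \<alpha>" "\<alpha> < 1" "0 < q" "0 < q'" "q \<le> R * q'" "0 < h" "h \<le> 1/2" "m \<ge> 1"
    and "\<bar>ln (q * (real m + \<alpha>)) - ln (q' * (real m' + \<alpha>))\<bar> \<le> h"
  shows "real m' + \<alpha> \<le> 4 * R * real m"
proof -
  have pos: "real m + \<alpha> > 0" "real m' + \<alpha> > 0" using assms by auto
  have "ln (q' * (real m' + \<alpha>)) \<le> h + ln (q * (real m + \<alpha>))" using assms by linarith
  hence "exp (ln (q' * (real m' + \<alpha>))) \<le> exp (h + ln (q * (real m + \<alpha>)))" by simp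
  hence "q' * (real m' + \<alpha>) \<le> exp h * (q * (real m + \<alpha>))"
    using assms pos by (simp add: exp_add)
  also have "exp h \<le> 2"
    using exp_bound[of h] assms power_mono[of h "1/2" 2] by (simp add: power2_eq_square)
  hence "exp h * (q * (real m + \<alpha>)) \<le> 2 * ((R * q') * (real m + \<alpha>))"
    using assms pos by (intro mult_mono mult_right_mono) auto
  finally have "q' * (real m' + \<alpha>) \<le> q' * (2 * R * (real m + \<alpha>))" by (simp add: mult_ac)
  hence "real m' + \<alpha> \<le> 2 * R * (real m + \<alpha>)" using assms by simp
  also have "\<dots> \<le> 2 * R * (2 * real m)"
  proof -
    have "0 < R * q'" using assms by linarith
    hence "R > 0" using assms by (simp add: zero_less_mult_iff)
    thus ?thesis using assms by (intro mult_left_mono) auto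
  qed
  finally show ?thesis by simp
qed

text \<open>For fixed q', two admissible m' are within a factor exp (2 h) of each other after adding
  \<alpha>. They differ by at most (exp (2 h) - 1) times their size, that is 4 h times 4 R
  m.\<close>

lemma card_near_frequencies:
  fixes \<alpha> q q' R h :: real
  assumes "0 < \<alpha>" "\<alpha> < 1" "0 < q" "0 < q'" "q \<le> R * q'" "0 < h" "h \<le> 1/2" "m \<ge> 1" "finite A"
  shows "real (card {m'\<in>A. \<bar>ln (q * (real m + \<alpha>)) - ln (q' * (real m' + \<alpha>))\<bar> \<le> h}) \<le> 1 + 16 * R * (h * real m)"
proof (rule card_le_of_spread)
  have "0 < R * q'" using assms by linarith
  hence R: "R > 0" using assms by (simp add: zero_less_mult_iff)
  thus "0 \<le> 16 * R * (h * real m)" using assms by auto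
  fix x y
  assume x: "x \<in> {m'\<in>A. \<bar>ln (q * (real m + \<alpha>)) - ln (q' * (real m' + \<alpha>))\<bar> \<le> h}"
    and y: "y \<in> {m'\<in>A. \<bar>ln (q * (real m + \<alpha>)) - ln (q' * (real m' + \<alpha>))\<bar> \<le> h}"
  have pos: "real x + \<alpha> > 0" "real y + \<alpha> > 0" using assms by auto
  have "ln (q' * (real x + \<alpha>)) \<le> 2 * h + ln (q' * (real y + \<alpha>))" using x y by auto
  hence "ln (real x + \<alpha>) \<le> 2 * h + ln (real y + \<alpha>)" using assms pos by (simp add: ln_mult)
  hence "exp (ln (real x + \<alpha>)) \<le> exp (2 * h + ln (real y + \<alpha>))" by simp
  hence "real x + \<alpha> \<le> exp (2 * h) * (real y + \<alpha>)" using pos by (simp add: exp_add)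
  hence "real x - real y \<le> (exp (2 * h) - 1) * (real y + \<alpha>)" by (simp add: algebra_simps)
  also have "exp (2 * h) - 1 \<le> 4 * h"
  proof -
    have "exp (2 * h) \<le> 1 + 2 * h + (2 * h)\<^sup>2" using assms by (intro exp_bound) auto
    moreover have "(2 * h)\<^sup>2 \<le> 1 * (2 * h)" unfolding power2_eq_square using assms by (intro mult_right_mono) auto
    ultimately show ?thesis by simp
  qed
  hence "(exp (2 * h) - 1) * (real y + \<alpha>) \<le> (4 * h) * (4 * R * real m)"
    using near_frequency_bound[of \<alpha> q q' R h m y] assms y pos R by (intro mult_mono) auto
  finally show "real x - real y \<le> 16 * R * (h * real m)" by (simp add: mult_ac)
qed (use assms in auto)

text \<open>The terms are split at M0. For m < M0 every near neighbour has index at most 4 R M0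
  \<le> M, so the absence of relations up to M leaves the diagonal alone. For m \<ge> M0 up to C
  m^(2\<delta>) neighbours are tolerated, because 2\<sigma> - 2\<delta> = \<sigma> + 1/2 > 1 and M0
  makes that tail at most \<eta>/C. The factor 2 in front of S is the diagonal plus the Gaussian
  remainder.\<close>

lemma tail_mean_bound:
  fixes \<sigma> c \<delta> \<eta> S :: real
  assumes \<sigma>: "1/2 < \<sigma>" "\<sigma> < 1" and \<delta>: "\<delta> = (\<sigma> - 1/2) / 2" and c: "0 < c" "c < 1"
    and N: "N \<ge> 1" and K: "K \<ge> 1" and \<eta>: "\<eta> > 0"
    and S: "\<And>X. (\<Sum>m\<in>{N..<X}. real m powr - (2 * \<sigma>)) \<le> S"
  shows "\<exists>M\<ge>N. \<forall>\<alpha> \<theta>. c < \<alpha> \<and> \<alpha> < 1 \<and>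
    inj_on (\<lambda>(\<kappa>, m). shifted_monomial N \<kappa> \<alpha> * (real m + \<alpha>)) (({..<N} \<rightarrow>\<^sub>E {..K}) \<times> {N..M}) \<longrightarrow>
    (\<forall>\<^sub>F T in at_top. set_lebesgue_integral lborel {T/2..T}
      (\<lambda>t. (norm (phase_poly N K (\<lambda>n. - ln (real n + \<alpha>)) \<theta> t *
         (\<Sum>m\<in>{N..<nat \<lfloor>T powr (1 + \<delta>)\<rfloor>}. of_real ((real m + \<alpha>) powr - \<sigma>) * cis (- ln (real m + \<alpha>) * t))))\<^sup>2)
      \<le> gauss_const * T * (real (K ^ N) * (2 * S + \<eta>)))"
proof -
  define R where "R = (real N ^ K) ^ N / (c ^ K) ^ N"
  have cpos: "(c ^ K) ^ N > 0" using c by simp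
  have "(c ^ K) ^ N \<le> 1" using c by (intro power_le_one) (auto intro: power_le_one)
  moreover have "1 \<le> (real N ^ K) ^ N" using N by (intro one_le_power) auto
  ultimately have R1: "R \<ge> 1" unfolding R_def using cpos by (subst le_divide_eq_1_pos) auto
  \<comment> \<open>There are K^N choices of the neighbouring monomial, each with at most 1 + 16 R h
    m indices, and both 1 and h m are at most m^(2\<delta>).\<close>
  define C where "C = real (K ^ N) * (1 + 16 * R)"
  have C: "C > 0" using K R1 by (simp add: C_def)
  have \<delta>': "0 < \<delta>" "\<delta> < 1/4" "2 * \<sigma> - 2 * \<delta> > 1" using \<sigma> by (auto simp: \<delta> field_simps)
  obtain M1 where M1: "\<And>m X. m \<ge> M1 \<Longrightarrow> (\<Sum>i\<in>{m..<X}. real i powr - (2 * \<sigma> - 2 * \<delta>)) \<le> \<eta> / C"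
    using powr_tail_small[of "2 * \<sigma> - 2 * \<delta>" "\<eta> / C"] \<delta>' \<eta> C by auto
  define M0 where "M0 = max N M1"
  define M where "M = nat \<lceil>4 * R * real M0\<rceil>"
  have M: "real M \<ge> 4 * R * real M0" unfolding M_def by linarith
  have "1 * real M0 \<le> 4 * R * real M0" using R1 by (intro mult_right_mono) auto
  hence M0M: "M0 \<le> M" using M by linarith
  show ?thesis
  proof (intro exI[of _ M] conjI allI impI)
    show "N \<le> M" using M0M by (simp add: M0_def)
    fix \<alpha> \<theta>
    assume *: "c < \<alpha> \<and> \<alpha> < 1 \<and>
      inj_on (\<lambda>(\<kappa>, m). shifted_monomial N \<kappa> \<alpha> * (real m + \<alpha>)) (({..<N} \<rightarrow>\<^sub>E {..K}) \<times> {N..M})"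
    define q where "q \<kappa> = shifted_monomial N \<kappa> \<alpha>" for \<kappa>
    define \<Omega> where "\<Omega> = ({..<N} \<rightarrow>\<^sub>E {..<K})"
    define J where "J = \<Omega> \<times> {N..M}"
    define l where "l n = - ln (real n + \<alpha>)" for n
    define L where "L = (\<lambda>(\<kappa>, m). phase_freq N l \<kappa> + l m)"
    have \<alpha>: "0 < \<alpha>" "\<alpha> < 1" using * c by auto
    have \<Omega>K: "\<Omega> \<subseteq> ({..<N} \<rightarrow>\<^sub>E {..K})" unfolding \<Omega>_def by (intro PiE_mono) auto
    have \<Omega>: "finite \<Omega>" "card \<Omega> = K ^ N" unfolding \<Omega>_def by (auto simp: card_PiE intro!: finite_PiE)
    have q: "(c ^ K) ^ N \<le> q \<kappa>" "q \<kappa> \<le> (real N ^ K) ^ N" if "\<kappa> \<in> \<Omega>" for \<kappa>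
      unfolding q_def using * c that \<Omega>K by (auto intro!: shifted_monomial_bounds)
    have qpos: "q \<kappa> > 0" if "\<kappa> \<in> \<Omega>" for \<kappa> using q[OF that] cpos by linarith
    have qR: "q \<kappa> \<le> R * q \<kappa>'" if "\<kappa> \<in> \<Omega>" "\<kappa>' \<in> \<Omega>" for \<kappa> \<kappa>'
    proof -
      have "q \<kappa> \<le> R * (c ^ K) ^ N" unfolding R_def using q[OF that(1)] c by simp
      also have "\<dots> \<le> R * q \<kappa>'" using q[OF that(2)] R1 by (intro mult_left_mono) auto
      finally show ?thesis .
    qed
    have L: "L (\<kappa>, m) = - ln (q \<kappa> * (real m + \<alpha>))" if "\<kappa> \<in> \<Omega>" for \<kappa> m
      using \<alpha> qpos[OF that] unfolding L_def l_def q_def prod.case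
      by (subst phase_freq_ln) (auto simp: ln_mult add_nonneg_pos)
    have "inj_on L J"
    proof (rule inj_onI, clarify)
      fix \<kappa> m \<kappa>' m'
      assume J: "(\<kappa>, m) \<in> J" "(\<kappa>', m') \<in> J" and eq: "L (\<kappa>, m) = L (\<kappa>', m')"
      have k: "\<kappa> \<in> \<Omega>" "\<kappa>' \<in> \<Omega>" "m \<in> {N..M}" "m' \<in> {N..M}" using J by (auto simp: J_def)
      have "q \<kappa> * (real m + \<alpha>) > 0" "q \<kappa>' * (real m' + \<alpha>) > 0"
        using qpos k \<alpha> by (auto simp: add_nonneg_pos)
      hence "q \<kappa> * (real m + \<alpha>) = q \<kappa>' * (real m' + \<alpha>)" using eq k by (simp add: L)
      with * k \<Omega>K have "(\<kappa>, m) = (\<kappa>', m')"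
        unfolding q_def by (intro inj_onD[of "\<lambda>(\<kappa>, m). shifted_monomial N \<kappa> \<alpha> * (real m + \<alpha>)"]) auto
      thus "\<kappa> = \<kappa>' \<and> m = m'" by simp
    qed
    moreover have "finite J" using \<Omega> by (simp add: J_def)
    ultimately obtain h0 where h0: "h0 > 0" "\<And>i j. i \<in> J \<Longrightarrow> j \<in> J \<Longrightarrow> \<bar>L i - L j\<bar> \<le> h0 \<Longrightarrow> i = j"
      using finite_gap[of J L] by blast
    have "((\<lambda>T. T powr (\<delta> - 1)) \<longlongrightarrow> 0) at_top"
      using \<delta>' by (intro tendsto_neg_powr filterlim_ident) auto
    hence e1: "\<forall>\<^sub>F T in at_top. T powr (\<delta> - 1) < min h0 (1/2)" using h0 by (intro order_tendstoD) auto
    have "((\<lambda>T. real (K ^ N) * T powr (1 + \<delta>) * exp (- (T powr \<delta>)\<^sup>2 / 2)) \<longlongrightarrow> 0) at_top"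
      using \<delta>' by real_asymp
    hence e2: "\<forall>\<^sub>F T in at_top. real (K ^ N) * T powr (1 + \<delta>) * exp (- (T powr \<delta>)\<^sup>2 / 2) < 1"
      by (simp add: order_tendstoD)
    show "\<forall>\<^sub>F T in at_top. set_lebesgue_integral lborel {T/2..T}
      (\<lambda>t. (norm (phase_poly N K (\<lambda>n. - ln (real n + \<alpha>)) \<theta> t *
         (\<Sum>m\<in>{N..<nat \<lfloor>T powr (1 + \<delta>)\<rfloor>}. of_real ((real m + \<alpha>) powr - \<sigma>) * cis (- ln (real m + \<alpha>) * t))))\<^sup>2)
      \<le> gauss_const * T * (real (K ^ N) * (2 * S + \<eta>))"
      using e1 e2 eventually_ge_at_top[of 1]
    proof eventually_elim
      case (elim T)
      \<comment> \<open>The window balances two demands: T h = T^\<delta> lets the Gaussian beat the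
        number of frequencies, of order T^(1+\<delta>), while h m stays below m^(2\<delta>) in the
        whole range.\<close>
      define h where "h = T powr (\<delta> - 1)"
      define X where "X = nat \<lfloor>T powr (1 + \<delta>)\<rfloor>"
      define I where "I = \<Omega> \<times> {N..<X}"
      define r where "r m = (real m + \<alpha>) powr - \<sigma>" for m
      define a where "a = (\<lambda>(\<kappa>, m). phase_coeff N \<theta> \<kappa> * of_real (r m))"
      define g where "g m = (if m \<ge> M0 then C * real m powr (2 * \<delta>) else 0)" for m
      have h: "0 < h" "h \<le> h0" "h \<le> 1/2" using elim by (auto simp: h_def)
      have Th: "T * h = T powr \<delta>" using elim by (simp add: h_def powr_mult_base)
      have XT: "real X \<le> T powr (1 + \<delta>)" unfolding X_def using powr_ge_zero[of T "1 + \<delta>"] by linarith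
      have finI: "finite I" using \<Omega> by (simp add: I_def)
      have far: "real (card I) * exp (- (T * h)\<^sup>2 / 2) \<le> 1"
      proof -
        have "real (card I) \<le> real (K ^ N) * T powr (1 + \<delta>)"
          using XT \<Omega> by (auto simp: I_def card_cartesian_product intro!: mult_left_mono)
        hence "real (card I) * exp (- (T * h)\<^sup>2 / 2) \<le> real (K ^ N) * T powr (1 + \<delta>) * exp (- (T * h)\<^sup>2 / 2)"
          by (intro mult_right_mono) auto
        thus ?thesis using elim unfolding Th by linarith
      qed
      \<comment> \<open>This rests on (1+\<delta>)(1-2\<delta>) = 1 - \<delta> - 2\<delta>^2 \<le> 1
        - \<delta>, so m^(1-2\<delta>) \<le> T^(1-\<delta>) = 1/h for m < X.\<close>
      have hm: "h * real m \<le> real m powr (2 * \<delta>)" if "m \<ge> 1" "m < X" for m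
      proof -
        have "real m powr (1 - 2 * \<delta>) \<le> (T powr (1 + \<delta>)) powr (1 - 2 * \<delta>)"
          using that XT \<delta>' by (intro powr_mono2) auto
        also have "\<dots> = T powr ((1 + \<delta>) * (1 - 2 * \<delta>))" by (rule powr_powr)
        also have "\<dots> \<le> T powr (1 - \<delta>)"
          using elim \<delta>' by (intro powr_mono) (auto simp: algebra_simps)
        finally have "h * real m powr (1 - 2 * \<delta>) \<le> h * T powr (1 - \<delta>)" using h by (intro mult_left_mono) auto
        also have "\<dots> = 1" using elim by (simp add: h_def flip: powr_add)
        finally have "h * real m powr (1 - 2 * \<delta>) \<le> 1" .
        hence "h * real m powr (1 - 2 * \<delta>) * real m powr (2 * \<delta>) \<le> 1 * real m powr (2 * \<delta>)"
          by (intro mult_right_mono) auto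
        also have "h * real m powr (1 - 2 * \<delta>) * real m powr (2 * \<delta>) = h * real m"
          using that by (simp add: mult.assoc flip: powr_add)
        finally show ?thesis by simp
      qed
      have near: "real (card {j\<in>I. \<bar>L i - L j\<bar> \<le> h}) \<le> 1 + g (snd i)" if i: "i \<in> I" for i
      proof -
        obtain \<kappa> m where im: "i = (\<kappa>, m)" by (cases i)
        have km: "\<kappa> \<in> \<Omega>" "m \<ge> N" "m < X" using i by (auto simp: im I_def)
        have diff: "\<bar>L i - L (\<kappa>', m')\<bar> = \<bar>ln (q \<kappa> * (real m + \<alpha>)) - ln (q \<kappa>' * (real m' + \<alpha>))\<bar>"
          if "\<kappa>' \<in> \<Omega>" for \<kappa>' m'
          using that km by (simp add: im L)
        show ?thesis
        proof (cases "m \<ge> M0")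
          case False
          have "j = i" if j: "j \<in> I" "\<bar>L i - L j\<bar> \<le> h" for j
          proof -
            obtain \<kappa>' m' where jm: "j = (\<kappa>', m')" by (cases j)
            have km': "\<kappa>' \<in> \<Omega>" "m' \<ge> N" using j by (auto simp: jm I_def)
            have "real m' + \<alpha> \<le> 4 * R * real m"
              using j(2) km km' \<alpha> qpos qR h N unfolding jm diff[OF km'(1)]
              by (intro near_frequency_bound[of \<alpha> "q \<kappa>" "q \<kappa>'" R h]) auto
            also have "\<dots> \<le> 4 * R * real M0" using False R1 by (intro mult_left_mono) auto
            finally have "m' \<le> M" using M \<alpha> by linarith
            hence "j \<in> J" "i \<in> J" using km km' False M0M by (auto simp: J_def im jm)
            thus ?thesis using h0(2)[of i j] j h by auto
          qed
          hence "{j\<in>I. \<bar>L i - L j\<bar> \<le> h} \<subseteq> {i}" by blast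
          from card_mono[OF _ this] show ?thesis using False by (simp add: g_def im)
        next
          case True
          have "{j\<in>I. \<bar>L i - L j\<bar> \<le> h} \<subseteq> (SIGMA \<kappa>':\<Omega>. {m'\<in>{N..<X}. \<bar>ln (q \<kappa> * (real m + \<alpha>)) - ln (q \<kappa>' * (real m' + \<alpha>))\<bar> \<le> h})"
            using diff by (auto simp: I_def)
          hence "card {j\<in>I. \<bar>L i - L j\<bar> \<le> h} \<le> card (SIGMA \<kappa>':\<Omega>. {m'\<in>{N..<X}. \<bar>ln (q \<kappa> * (real m + \<alpha>)) - ln (q \<kappa>' * (real m' + \<alpha>))\<bar> \<le> h})"
            using \<Omega> by (intro card_mono finite_SigmaI) auto
          also have "\<dots> = (\<Sum>\<kappa>'\<in>\<Omega>. card {m'\<in>{N..<X}. \<bar>ln (q \<kappa> * (real m + \<alpha>)) - ln (q \<kappa>' * (real m' + \<alpha>))\<bar> \<le> h})"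
            using \<Omega> by (intro card_SigmaI) auto
          finally have "real (card {j\<in>I. \<bar>L i - L j\<bar> \<le> h}) \<le>
              (\<Sum>\<kappa>'\<in>\<Omega>. real (card {m'\<in>{N..<X}. \<bar>ln (q \<kappa> * (real m + \<alpha>)) - ln (q \<kappa>' * (real m' + \<alpha>))\<bar> \<le> h}))"
            by (simp flip: of_nat_sum)
          also have "\<dots> \<le> (\<Sum>\<kappa>'\<in>\<Omega>. (1 + 16 * R) * real m powr (2 * \<delta>))"
          proof (rule sum_mono)
            fix \<kappa>' assume k': "\<kappa>' \<in> \<Omega>"
            have "real (card {m'\<in>{N..<X}. \<bar>ln (q \<kappa> * (real m + \<alpha>)) - ln (q \<kappa>' * (real m' + \<alpha>))\<bar> \<le> h}) \<le> 1 + 16 * R * (h * real m)"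
              using km k' \<alpha> qpos qR h N by (intro card_near_frequencies) auto
            also have "\<dots> \<le> real m powr (2 * \<delta>) + 16 * R * real m powr (2 * \<delta>)"
              using hm[of m] km N R1 \<delta>' by (intro add_mono mult_left_mono) (auto intro!: ge_one_powr_ge_zero)
            finally show "real (card {m'\<in>{N..<X}. \<bar>ln (q \<kappa> * (real m + \<alpha>)) - ln (q \<kappa>' * (real m' + \<alpha>))\<bar> \<le> h}) \<le>
                (1 + 16 * R) * real m powr (2 * \<delta>)" by (simp add: distrib_right)
          qed
          also have "\<dots> = g m" using True \<Omega> by (simp add: g_def C_def)
          finally show ?thesis by (simp add: im)
        qed
      qed
      have "phase_poly N K (\<lambda>n. - ln (real n + \<alpha>)) \<theta> t *
         (\<Sum>m\<in>{N..<X}. of_real ((real m + \<alpha>) powr - \<sigma>) * cis (- ln (real m + \<alpha>) * t)) = (\<Sum>i\<in>I. a i * cis (L i * t))" for t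
      proof -
        have "phase_poly N K l \<theta> t * (\<Sum>m\<in>{N..<X}. of_real (r m) * cis (l m * t)) =
            (\<Sum>\<kappa>\<in>\<Omega>. \<Sum>m\<in>{N..<X}. (phase_coeff N \<theta> \<kappa> * cis (phase_freq N l \<kappa> * t)) * (of_real (r m) * cis (l m * t)))"
          unfolding phase_poly_expand \<Omega>_def[symmetric] by (rule sum_product)
        also have "\<dots> = (\<Sum>\<kappa>\<in>\<Omega>. \<Sum>m\<in>{N..<X}. a (\<kappa>, m) * cis (L (\<kappa>, m) * t))"
        proof (intro sum.cong refl)
          fix \<kappa> m
          have "cis ((phase_freq N l \<kappa> + l m) * t) = cis (phase_freq N l \<kappa> * t) * cis (l m * t)"
            by (simp add: cis_mult distrib_right)
          thus "(phase_coeff N \<theta> \<kappa> * cis (phase_freq N l \<kappa> * t)) * (of_real (r m) * cis (l m * t)) = a (\<kappa>, m) * cis (L (\<kappa>, m) * t)"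
            by (simp add: a_def L_def)
        qed
        also have "\<dots> = (\<Sum>i\<in>I. a i * cis (L i * t))"
          unfolding I_def by (simp add: sum.cartesian_product)
        finally show ?thesis by (simp add: l_def[abs_def] r_def)
      qed
      hence "set_lebesgue_integral lborel {T/2..T}
      (\<lambda>t. (norm (phase_poly N K (\<lambda>n. - ln (real n + \<alpha>)) \<theta> t *
         (\<Sum>m\<in>{N..<nat \<lfloor>T powr (1 + \<delta>)\<rfloor>}. of_real ((real m + \<alpha>) powr - \<sigma>) * cis (- ln (real m + \<alpha>) * t))))\<^sup>2) =
        set_lebesgue_integral lborel {T/2..T} (\<lambda>t. (norm (\<Sum>i\<in>I. a i * cis (L i * t)))\<^sup>2)"
        unfolding X_def[symmetric] by (simp only:)
      also have "\<dots> \<le> gauss_const * T * (\<Sum>i\<in>I. (norm (a i))\<^sup>2 * (real (card {j\<in>I. \<bar>L i - L j\<bar> \<le> h}) + real (card I) * exp (- (T * h)\<^sup>2 / 2)))"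
        using elim h finI by (intro interval_mean_square_near) auto
      also have "\<dots> \<le> gauss_const * T * (\<Sum>i\<in>I. real (snd i) powr - (2 * \<sigma>) * (2 + g (snd i)))"
      proof (intro mult_left_mono sum_mono mult_mono)
        fix i assume i: "i \<in> I"
        obtain \<kappa> m where im: "i = (\<kappa>, m)" by (cases i)
        have m: "m \<ge> 1" using i N by (auto simp: im I_def)
        have "(norm (a i))\<^sup>2 = (real m + \<alpha>) powr - \<sigma> * (real m + \<alpha>) powr - \<sigma>"
          by (simp add: a_def im norm_mult r_def power2_eq_square)
        also have "\<dots> = (real m + \<alpha>) powr - (2 * \<sigma>)" by (simp flip: powr_add)
        also have "\<dots> \<le> real m powr - (2 * \<sigma>)" using m \<alpha> \<sigma> by (intro powr_mono2') auto
        finally show "(norm (a i))\<^sup>2 \<le> real (snd i) powr - (2 * \<sigma>)" by (simp add: im)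
        show "real (card {j\<in>I. \<bar>L i - L j\<bar> \<le> h}) + real (card I) * exp (- (T * h)\<^sup>2 / 2) \<le> 2 + g (snd i)"
          using near[OF i] far by linarith
      qed (use elim gauss_const_pos in auto)
      also have "(\<Sum>i\<in>I. real (snd i) powr - (2 * \<sigma>) * (2 + g (snd i))) =
          real (K ^ N) * (\<Sum>m\<in>{N..<X}. real m powr - (2 * \<sigma>) * (2 + g m))"
        unfolding I_def using sum.cartesian_product[of "\<lambda>_ m. real m powr - (2 * \<sigma>) * (2 + g m)" "{N..<X}" \<Omega>] \<Omega>
        by (simp add: case_prod_unfold)
      also have "(\<Sum>m\<in>{N..<X}. real m powr - (2 * \<sigma>) * (2 + g m)) =
          2 * (\<Sum>m\<in>{N..<X}. real m powr - (2 * \<sigma>)) + (\<Sum>m\<in>{N..<X}. real m powr - (2 * \<sigma>) * g m)"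
        by (simp add: sum_distrib_left sum.distrib[symmetric] algebra_simps)
      also have "(\<Sum>m\<in>{N..<X}. real m powr - (2 * \<sigma>) * g m) = (\<Sum>m\<in>{M0..<X}. C * real m powr - (2 * \<sigma> - 2 * \<delta>))"
      proof (rule sum.mono_neutral_cong_right)
        show "real m powr - (2 * \<sigma>) * g m = C * real m powr - (2 * \<sigma> - 2 * \<delta>)" if "m \<in> {M0..<X}" for m
          using that by (simp add: g_def flip: powr_add)
      qed (auto simp: M0_def g_def)
      also have "\<dots> = C * (\<Sum>m\<in>{M0..<X}. real m powr - (2 * \<sigma> - 2 * \<delta>))" by (rule sum_distrib_left[symmetric])
      also have "gauss_const * T * (real (K ^ N) * (2 * (\<Sum>m\<in>{N..<X}. real m powr - (2 * \<sigma>)) + \<dots>)) \<le>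
          gauss_const * T * (real (K ^ N) * (2 * S + C * (\<eta> / C)))"
        using elim gauss_const_pos S C by (intro mult_left_mono add_mono M1) (auto simp: M0_def)
      finally show ?case using C by simp
    qed
  qed
qed

section \<open>Density of the values\<close>

text \<open>A weighted Chebyshev inequality: the part of the weight that lies off the good set is
  paid for by Q, and the rest forces the good set to have positive measure because the weight is
  bounded.\<close>

lemma interval_integral_le_measure:
  fixes W Q :: "real \<Rightarrow> real"
  assumes "continuous_on {a..b} W" "continuous_on {a..b} Q" "G \<in> sets borel" "G \<subseteq> {a..b}"
    and W: "\<And>t. t \<in> {a..b} \<Longrightarrow> W t \<le> V" and Q: "\<And>t. t \<in> {a..b} \<Longrightarrow> 0 \<le> Q t" and "0 \<le> V"
    and bad: "\<And>t. t \<in> {a..b} - G \<Longrightarrow> W t \<le> Q t"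
  shows "set_lebesgue_integral lborel {a..b} W \<le> V * measure lborel G + set_lebesgue_integral lborel {a..b} Q"
proof -
  have G: "emeasure lborel G < \<infinity>"
    using emeasure_mono[OF assms(4), of lborel] by (auto simp: emeasure_lborel_Icc_eq split: if_splits intro: le_less_trans)
  have intG: "integrable lborel (indicator G :: real \<Rightarrow> real)"
    using assms(3) G by (intro integrable_real_indicator) auto
  have int1: "set_integrable lborel {a..b} (\<lambda>t. V * indicator G t)"
    unfolding set_integrable_def
    by (rule Bochner_Integration.integrable_bound[OF integrable_mult_right[OF intG, of V]])
       (use assms(3) in \<open>auto split: split_indicator\<close>)
  have int2: "set_integrable lborel {a..b} Q" "set_integrable lborel {a..b} W"
    using assms by (auto intro: set_integrable_interval_continuous)
  have "set_lebesgue_integral lborel {a..b} W \<le> set_lebesgue_integral lborel {a..b} (\<lambda>t. V * indicator G t + Q t)"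
  proof (rule set_integral_mono)
    fix t assume "t \<in> {a..b}"
    thus "W t \<le> V * indicator G t + Q t"
      using W[of t] Q[of t] bad[of t] by (cases "t \<in> G") auto
  qed (use int1 int2 in \<open>auto intro: set_integral_add\<close>)
  also have "\<dots> = set_lebesgue_integral lborel {a..b} (\<lambda>t. V * indicator G t) + set_lebesgue_integral lborel {a..b} Q"
    using int1 int2 by (intro set_integral_add)
  also have "set_lebesgue_integral lborel {a..b} (\<lambda>t. V * indicator G t) = (LINT t|lborel. V * indicator G t)"
    unfolding set_lebesgue_integral_def
    by (rule Bochner_Integration.integral_cong) (use assms(4) in \<open>auto split: split_indicator\<close>)
  also have "\<dots> = V * measure lborel G" using assms(3) by simp
  finally show ?thesis .
qed

lemma quad_irrationals_bounds:
  assumes "\<alpha> \<in> quad_irrationals c d"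
  shows "c < \<alpha>" "\<alpha> < 1"
  using assms unfolding quad_irrationals_def mem_Collect_eq by (elim exE conjE disjE; linarith)+

lemma norm_sum_squared_le:
  fixes x :: "nat \<Rightarrow> complex"
  shows "(norm (\<Sum>n<N. x n))\<^sup>2 \<le> real N * (\<Sum>n<N. (norm (x n))\<^sup>2)"
proof -
  have "(norm (\<Sum>n<N. x n))\<^sup>2 \<le> (\<Sum>n<N. 1 * norm (x n))\<^sup>2"
    by (intro power_mono) (auto intro: norm_sum)
  also have "\<dots> \<le> (\<Sum>n<N. 1\<^sup>2) * (\<Sum>n<N. (norm (x n))\<^sup>2)"
    by (rule Cauchy_Schwarz_ineq_sum)
  finally show ?thesis by simp
qed

lemma hurwitz_value_density:
  fixes c \<sigma> \<epsilon> :: real and z\<^sub>0 :: complex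
  assumes c: "0 < c" "c < 1" and \<sigma>: "1 / 2 < \<sigma>" "\<sigma> < 1" and \<epsilon>: "\<epsilon> > 0"
  shows "\<exists>E. finite E \<and> (\<forall>\<alpha>. c < \<alpha> \<and> \<alpha> < 1 \<and> \<alpha> \<notin> E \<longrightarrow>
       Liminf at_top (\<lambda>T :: real. ereal (1 / T *
         measure lebesgue {t \<in> {0..T}. norm (hurwitz_zeta (Complex \<sigma> t) \<alpha> - z\<^sub>0) < \<epsilon>})) > 0)"
proof -
  define \<delta> where "\<delta> = (\<sigma> - 1/2) / 2"
  have \<delta>: "0 < \<delta>" "(1 + \<delta>) * (1 - \<sigma>) < 1"
  proof -
    show "0 < \<delta>" using \<sigma> by (simp add: \<delta>_def)
    have "(1 + \<delta>) * (1 - \<sigma>) \<le> 2 * (1 - \<sigma>)" using \<sigma> by (intro mult_right_mono) (auto simp: \<delta>_def)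
    thus "(1 + \<delta>) * (1 - \<sigma>) < 1" using \<sigma> by simp
  qed
  \<comment> \<open>Makes the tail contribute \<epsilon>^2/256 T V. The phase errors contribute the
    same, and after multiplication by 16/\<epsilon>^2 both together amount to T V / 8.\<close>
  define \<rho> where "\<rho> = \<epsilon>\<^sup>2 / (256 * gauss_const)"
  have \<rho>: "\<rho> > 0" using \<epsilon> gauss_const_pos by (simp add: \<rho>_def)
  obtain N1 where N1: "\<And>N \<alpha>. N \<ge> N1 \<Longrightarrow> c < \<alpha> \<Longrightarrow> \<alpha> < 1 \<Longrightarrow>
      \<exists>\<theta>. norm ((\<Sum>n<N. of_real ((real n + \<alpha>) powr - \<sigma>) * cis (\<theta> n)) - z\<^sub>0) \<le> \<epsilon> / 8"
    using powr_phases_exist[of \<sigma> c "\<epsilon> / 8" z\<^sub>0] \<sigma> c \<epsilon> by auto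
  obtain N2 where N2: "\<And>N X. N \<ge> N2 \<Longrightarrow> (\<Sum>m\<in>{N..<X}. real m powr - (2 * \<sigma>)) \<le> \<rho> / 4"
    using powr_tail_small[of "2 * \<sigma>" "\<rho> / 4"] \<sigma> \<rho> by auto
  define N where "N = max 1 (max N1 N2)"
  have N: "N \<ge> 1" "N \<ge> N1" "N \<ge> N2" by (auto simp: N_def)
  \<comment> \<open>The phase errors sum to 4 N^2 c^(-2\<sigma>) \<open>gauss_const\<close> T
    K^(N-1), with one factor N from Cauchy-Schwarz and one from the number of terms. Requiring at
    most \<epsilon>^2/256 T K^N gives 1024 = 4 * 256.\<close>
  define K where "K = nat \<lceil>1024 * real N * real N * c powr - (2 * \<sigma>) * gauss_const / \<epsilon>\<^sup>2\<rceil> + 1"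
  have K: "K \<ge> 1" by (simp add: K_def)
  have K': "1024 * real N * real N * c powr - (2 * \<sigma>) * gauss_const \<le> \<epsilon>\<^sup>2 * real K"
  proof -
    have "1024 * real N * real N * c powr - (2 * \<sigma>) * gauss_const / \<epsilon>\<^sup>2 \<le> real K" unfolding K_def by linarith
    thus ?thesis using \<epsilon> by (simp add: field_simps)
  qed
  define V where "V = real (K ^ N)"
  have V: "V \<ge> 1" using K by (simp add: V_def)
  obtain M where M: "M \<ge> N" "\<And>\<alpha> \<theta>. c < \<alpha> \<Longrightarrow> \<alpha> < 1 \<Longrightarrow>
    inj_on (\<lambda>(\<kappa>, m). shifted_monomial N \<kappa> \<alpha> * (real m + \<alpha>)) (({..<N} \<rightarrow>\<^sub>E {..K}) \<times> {N..M}) \<Longrightarrow>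
    (\<forall>\<^sub>F T in at_top. set_lebesgue_integral lborel {T/2..T}
      (\<lambda>t. (norm (phase_poly N K (\<lambda>n. - ln (real n + \<alpha>)) \<theta> t *
         (\<Sum>m\<in>{N..<nat \<lfloor>T powr (1 + \<delta>)\<rfloor>}. of_real ((real m + \<alpha>) powr - \<sigma>) * cis (- ln (real m + \<alpha>) * t))))\<^sup>2)
      \<le> gauss_const * T * (real (K ^ N) * (2 * (\<rho> / 4) + \<rho> / 2)))"
    using tail_mean_bound[OF \<sigma> \<delta>_def c N(1) K, of "\<rho> / 2" "\<rho> / 4"] N2[OF N(3)] \<rho> by auto
  define E where "E = {\<alpha> :: real. \<not> inj_on (\<lambda>(\<kappa>, m). shifted_monomial N \<kappa> \<alpha> * (real m + \<alpha>))
     (({..<N} \<rightarrow>\<^sub>E {..K}) \<times> {N..M})}"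
  show ?thesis
  proof (intro exI[of _ E] conjI allI impI)
    show "finite E" unfolding E_def by (rule finite_multiplicative_relations)
    fix \<alpha> assume *: "c < \<alpha> \<and> \<alpha> < 1 \<and> \<alpha> \<notin> E"
    hence \<alpha>: "0 < \<alpha>" "\<alpha> < 1" "c < \<alpha>" using c by auto
    have inj: "inj_on (\<lambda>(\<kappa>, m). shifted_monomial N \<kappa> \<alpha> * (real m + \<alpha>)) (({..<N} \<rightarrow>\<^sub>E {..K}) \<times> {N..M})"
      using * by (simp add: E_def)
    obtain \<theta> where \<theta>: "norm ((\<Sum>n<N. of_real ((real n + \<alpha>) powr - \<sigma>) * cis (\<theta> n)) - z\<^sub>0) \<le> \<epsilon> / 8"
      using N1[OF N(2)] \<alpha> by blast
    define l where "l n = - ln (real n + \<alpha>)" for n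
    define r where "r n = (real n + \<alpha>) powr - \<sigma>" for n
    define P where "P = phase_poly N K l \<theta>"
    define Z where "Z t = hurwitz_zeta (Complex \<sigma> t) \<alpha>" for t
    have injf: "inj_on (phase_freq N l) ({..<N} \<rightarrow>\<^sub>E {..K})"
    proof (rule inj_onI)
      fix x y assume xy: "x \<in> {..<N} \<rightarrow>\<^sub>E {..K}" "y \<in> {..<N} \<rightarrow>\<^sub>E {..K}"
        and eq: "phase_freq N l x = phase_freq N l y"
      have "0 < (c ^ K) ^ N" using c by simp
      hence "shifted_monomial N x \<alpha> > 0" "shifted_monomial N y \<alpha> > 0"
        using shifted_monomial_bounds(1)[OF c(1) \<alpha>(3,2)] xy by (auto intro: less_le_trans)
      hence "shifted_monomial N x \<alpha> = shifted_monomial N y \<alpha>"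
        using eq unfolding l_def by (simp add: phase_freq_ln[OF \<alpha>(1)])
      \<comment> \<open>Multiplying both monomials by the same factor N + \<alpha> turns a relation
        between monomials into one between pairs; this needs N in the range up to M.\<close>
      hence "(x, N) = (y, N)"
        using xy M(1) by (intro inj_onD[OF inj]) auto
      thus "x = y" by simp
    qed
    obtain D where D: "\<And>T. T > 0 \<Longrightarrow> set_lebesgue_integral lborel {T/2..T} (\<lambda>t. (norm (P t))\<^sup>2) \<ge> T / 2 * V - D"
      using phase_poly_mean_lower[OF injf, of \<theta>] by (auto simp: P_def V_def)
    have contZ: "continuous_on UNIV Z"
      unfolding Z_def using \<sigma> \<alpha> by (intro continuous_on_hurwitz_zeta_line) auto
    have contP: "continuous_on S P" for S unfolding P_def by (rule continuous_on_phase_poly)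
    have meas: "{t \<in> {a..b}. norm (Z t - z\<^sub>0) < \<epsilon>} \<in> sets borel" for a b
    proof -
      have "(\<lambda>t. norm (Z t - z\<^sub>0)) \<in> borel_measurable borel"
        using contZ by (intro borel_measurable_continuous_onI continuous_intros)
      hence "{t. norm (Z t - z\<^sub>0) < \<epsilon>} \<in> sets borel" by measurable
      hence "{a..b} \<inter> {t. norm (Z t - z\<^sub>0) < \<epsilon>} \<in> sets borel" by (intro sets.Int) auto
      thus ?thesis by (simp add: Int_def)
    qed
    have ev1: "\<forall>\<^sub>F T in at_top. \<forall>t\<in>{T/2..T}. norm (Z t -
        (\<Sum>n<nat \<lfloor>T powr (1 + \<delta>)\<rfloor>. of_real (real n + \<alpha>) powr (- Complex \<sigma> t))) < \<epsilon> / 4"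
      unfolding Z_def using \<sigma> \<delta> \<alpha> \<epsilon> by (intro hurwitz_zeta_approx) auto
    have ev2: "\<forall>\<^sub>F T in at_top. \<forall>n\<in>{..<N}. set_lebesgue_integral lborel {T/2..T}
      (\<lambda>t. (norm (P t * (cis (l n * t) - cis (\<theta> n))))\<^sup>2) \<le> gauss_const * T * (4 * real (K ^ (N - 1)))"
      unfolding P_def using injf K by (intro eventually_ball_finite ballI phase_poly_diff_mean) auto
    have ev3: "\<forall>\<^sub>F T in at_top. set_lebesgue_integral lborel {T/2..T}
      (\<lambda>t. (norm (P t * (\<Sum>m\<in>{N..<nat \<lfloor>T powr (1 + \<delta>)\<rfloor>}. of_real (r m) * cis (l m * t))))\<^sup>2)
      \<le> gauss_const * T * (V * (2 * (\<rho> / 4) + \<rho> / 2))"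
      using M(2)[OF \<alpha>(3,2) inj, of \<theta>] unfolding P_def l_def[abs_def] r_def V_def .
    \<comment> \<open>The weight has total mass at least T V / 2 - D. With D \<le> T V / 4 and loss
      T V / 8 off the good set, at least T V / 8 remains on it; dividing by the maximum V^2 of the
      weight gives T / (8 V).\<close>
    have ev: "\<forall>\<^sub>F T in at_top. 1 / (8 * V) \<le> 1 / T * measure lebesgue {t \<in> {0..T}. norm (Z t - z\<^sub>0) < \<epsilon>}"
      using ev1 ev2 ev3 eventually_ge_at_top[of "real N"] eventually_ge_at_top[of "4 * D"] eventually_ge_at_top[of 1]
    proof eventually_elim
      case (elim T)
      define X where "X = nat \<lfloor>T powr (1 + \<delta>)\<rfloor>"
      define G where "G = {t \<in> {T/2..T}. norm (Z t - z\<^sub>0) < \<epsilon>}"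
      define A where "A t = (\<Sum>n<N. of_real (r n) * (cis (l n * t) - cis (\<theta> n)))" for t
      define B where "B t = (\<Sum>m\<in>{N..<X}. of_real (r m) * cis (l m * t))" for t
      define Q where "Q t = 16 / \<epsilon>\<^sup>2 * ((norm (P t * A t))\<^sup>2 + (norm (P t * B t))\<^sup>2)" for t
      have contA: "continuous_on S A" "continuous_on S B" for S
        unfolding A_def B_def by (intro continuous_intros)+
      have XN: "X \<ge> N"
      proof -
        have "T powr 1 \<le> T powr (1 + \<delta>)" using elim \<delta> by (intro powr_mono) auto
        hence "real N \<le> T powr (1 + \<delta>)" using elim by simp
        thus ?thesis unfolding X_def by (simp add: le_nat_floor)
      qed
      \<comment> \<open>Off the good set the truncation error (\<epsilon>/4) and the phase target
        error (\<epsilon>/8) cannot account for the distance \<epsilon>, so \<open>A t\<close> or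
        \<open>B t\<close> has norm at least \<epsilon>/4. Hence the factor 16/\<epsilon>^2 in
        \<open>Q\<close>.\<close>
      have bad: "(norm (P t))\<^sup>2 \<le> Q t" if t: "t \<in> {T/2..T} - G" for t
      proof -
        have "\<epsilon> \<le> norm (Z t - z\<^sub>0)" using t by (auto simp: G_def)
        moreover have "norm (Z t - (\<Sum>n<X. of_real (real n + \<alpha>) powr (- Complex \<sigma> t))) < \<epsilon> / 4"
          using elim(1) t by (simp add: X_def)
        moreover have "(\<Sum>n<X. of_real (real n + \<alpha>) powr (- Complex \<sigma> t)) = (\<Sum>n<X. of_real (r n) * cis (l n * t))"
          using \<alpha> by (intro sum.cong refl, subst of_real_powr_Complex) (auto simp: r_def l_def mult.commute add_nonneg_pos)
        moreover have "\<dots> = (\<Sum>n<N. of_real (r n) * cis (l n * t)) + B t"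
          unfolding B_def using XN by (simp add: lessThan_atLeast0 sum.atLeastLessThan_concat)
        moreover have "(\<Sum>n<N. of_real (r n) * cis (l n * t)) = A t + (\<Sum>n<N. of_real (r n) * cis (\<theta> n))"
          unfolding A_def by (simp add: sum_subtractf right_diff_distrib)
        ultimately have 1: "\<epsilon> \<le> norm (Z t - z\<^sub>0)"
          and 2: "norm (Z t - (A t + (\<Sum>n<N. of_real (r n) * cis (\<theta> n)) + B t)) < \<epsilon> / 4" by simp_all
        have "norm (Z t - z\<^sub>0) \<le> norm (Z t - (A t + (\<Sum>n<N. of_real (r n) * cis (\<theta> n)) + B t)) +
            (norm (A t) + norm (B t) + norm ((\<Sum>n<N. of_real (r n) * cis (\<theta> n)) - z\<^sub>0))"
        proof -
          define w C where "w = Z t - (A t + (\<Sum>n<N. of_real (r n) * cis (\<theta> n)) + B t)"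
            and "C = (\<Sum>n<N. of_real (r n) * cis (\<theta> n)) - z\<^sub>0"
          have "Z t - z\<^sub>0 = w + (A t + B t + C)" by (simp add: w_def C_def)
          hence "norm (Z t - z\<^sub>0) = norm (w + (A t + B t + C))" by (rule arg_cong)
          thus ?thesis
            using norm_triangle_ineq[of w "A t + B t + C"] norm_triangle_ineq[of "A t + B t" C]
              norm_triangle_ineq[of "A t" "B t"] unfolding w_def[symmetric] C_def[symmetric] by linarith
        qed
        hence "\<epsilon> / 4 \<le> norm (A t) \<or> \<epsilon> / 4 \<le> norm (B t)" using 1 2 \<theta> \<epsilon> by (auto simp: r_def)
        hence "(\<epsilon> / 4)\<^sup>2 \<le> (norm (A t))\<^sup>2 \<or> (\<epsilon> / 4)\<^sup>2 \<le> (norm (B t))\<^sup>2"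
          using \<epsilon> by (auto intro: power_mono)
        hence "(\<epsilon> / 4)\<^sup>2 \<le> (norm (A t))\<^sup>2 + (norm (B t))\<^sup>2"
          by (smt (verit) zero_le_power2)
        hence "1 \<le> 16 / \<epsilon>\<^sup>2 * ((norm (A t))\<^sup>2 + (norm (B t))\<^sup>2)"
          using \<epsilon> by (simp add: field_simps)
        hence "(norm (P t))\<^sup>2 * 1 \<le> (norm (P t))\<^sup>2 * (16 / \<epsilon>\<^sup>2 * ((norm (A t))\<^sup>2 + (norm (B t))\<^sup>2))"
          by (intro mult_left_mono) auto
        thus ?thesis by (simp add: Q_def norm_mult power_mult_distrib algebra_simps)
      qed
      have intA: "set_lebesgue_integral lborel {T/2..T} (\<lambda>t. (norm (P t * A t))\<^sup>2) \<le> \<epsilon>\<^sup>2 / 256 * (T * V)"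
      proof -
        have "set_lebesgue_integral lborel {T/2..T} (\<lambda>t. (norm (P t * A t))\<^sup>2) \<le>
            set_lebesgue_integral lborel {T/2..T} (\<lambda>t. \<Sum>n<N. real N * (r n)\<^sup>2 * (norm (P t * (cis (l n * t) - cis (\<theta> n))))\<^sup>2)"
        proof (rule set_integral_mono)
          fix t
          have "P t * A t = (\<Sum>n<N. of_real (r n) * (P t * (cis (l n * t) - cis (\<theta> n))))"
            unfolding A_def sum_distrib_left by (simp add: mult_ac)
          thus "(norm (P t * A t))\<^sup>2 \<le> (\<Sum>n<N. real N * (r n)\<^sup>2 * (norm (P t * (cis (l n * t) - cis (\<theta> n))))\<^sup>2)"
            using norm_sum_squared_le[of "\<lambda>n. of_real (r n) * (P t * (cis (l n * t) - cis (\<theta> n)))" N]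
            by (simp add: norm_mult power_mult_distrib sum_distrib_left mult.assoc)
        qed (auto intro!: set_integrable_interval_continuous continuous_intros contA contP)
        also have "\<dots> = (\<Sum>n<N. set_lebesgue_integral lborel {T/2..T} (\<lambda>t. real N * (r n)\<^sup>2 * (norm (P t * (cis (l n * t) - cis (\<theta> n))))\<^sup>2))"
          by (rule set_integral_sum) (auto intro!: set_integrable_interval_continuous continuous_intros contP)
        also have "\<dots> = (\<Sum>n<N. real N * (r n)\<^sup>2 * set_lebesgue_integral lborel {T/2..T} (\<lambda>t. (norm (P t * (cis (l n * t) - cis (\<theta> n))))\<^sup>2))"
          by simp
        also have "\<dots> \<le> (\<Sum>n<N. real N * c powr - (2 * \<sigma>) * (gauss_const * T * (4 * real (K ^ (N - 1)))))"
        proof (intro sum_mono mult_mono mult_left_mono)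
          fix n assume n: "n \<in> {..<N}"
          have "(r n)\<^sup>2 = (real n + \<alpha>) powr - (2 * \<sigma>)"
            by (simp add: r_def power2_eq_square flip: powr_add)
          also have "\<dots> \<le> c powr - (2 * \<sigma>)" using c \<alpha> \<sigma> by (intro powr_mono2') auto
          finally show "(r n)\<^sup>2 \<le> c powr - (2 * \<sigma>)" .
          show "set_lebesgue_integral lborel {T/2..T} (\<lambda>t. (norm (P t * (cis (l n * t) - cis (\<theta> n))))\<^sup>2)
            \<le> gauss_const * T * (4 * real (K ^ (N - 1)))" using elim(2) n by blast
        qed (auto simp: set_lebesgue_integral_def intro!: Bochner_Integration.integral_nonneg)
        also have "\<dots> = (1024 * real N * real N * c powr - (2 * \<sigma>) * gauss_const) * (T * real (K ^ (N - 1)) / 256)"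
          by simp
        also have "\<dots> \<le> (\<epsilon>\<^sup>2 * real K) * (T * real (K ^ (N - 1)) / 256)"
          using K' elim by (intro mult_right_mono) auto
        also have "\<dots> = \<epsilon>\<^sup>2 / 256 * (T * (real K * real (K ^ (N - 1))))" by simp
        also have "real K * real (K ^ (N - 1)) = V"
          unfolding V_def using N(1) by (simp flip: power_Suc)
        finally show ?thesis .
      qed
      have intB: "set_lebesgue_integral lborel {T/2..T} (\<lambda>t. (norm (P t * B t))\<^sup>2) \<le> \<epsilon>\<^sup>2 / 256 * (T * V)"
      proof -
        have "set_lebesgue_integral lborel {T/2..T} (\<lambda>t. (norm (P t * B t))\<^sup>2) \<le> gauss_const * T * (V * (2 * (\<rho> / 4) + \<rho> / 2))"
          using elim(3) unfolding B_def X_def .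
        also have "\<dots> = (gauss_const * \<rho>) * (T * V)" by simp
        also have "gauss_const * \<rho> = \<epsilon>\<^sup>2 / 256" using gauss_const_pos by (simp add: \<rho>_def)
        finally show ?thesis .
      qed
      have "set_lebesgue_integral lborel {T/2..T} Q = 16 / \<epsilon>\<^sup>2 * (set_lebesgue_integral lborel {T/2..T} (\<lambda>t. (norm (P t * A t))\<^sup>2) +
          set_lebesgue_integral lborel {T/2..T} (\<lambda>t. (norm (P t * B t))\<^sup>2))"
        unfolding Q_def
        by (subst set_integral_mult_right, subst set_integral_add)
           (auto intro!: set_integrable_interval_continuous continuous_intros contA contP)
      also have "\<dots> \<le> 16 / \<epsilon>\<^sup>2 * (\<epsilon>\<^sup>2 / 256 * (T * V) + \<epsilon>\<^sup>2 / 256 * (T * V))"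
        using intA intB by (intro mult_left_mono add_mono) auto
      also have "\<dots> = T * V / 8" using \<epsilon> by simp
      finally have intQ: "set_lebesgue_integral lborel {T/2..T} Q \<le> T * V / 8" .
      have "T / 2 * V - D \<le> set_lebesgue_integral lborel {T/2..T} (\<lambda>t. (norm (P t))\<^sup>2)"
        using D elim by simp
      also have "\<dots> \<le> V\<^sup>2 * measure lborel G + set_lebesgue_integral lborel {T/2..T} Q"
      proof (rule interval_integral_le_measure)
        show "(norm (P t))\<^sup>2 \<le> V\<^sup>2" for t
          unfolding P_def V_def by (intro power_mono norm_phase_poly_le) auto
        show "G \<in> sets borel" unfolding G_def by (rule meas)
      qed (use bad contA contP \<epsilon> in \<open>auto simp: G_def Q_def intro!: continuous_intros\<close>)
      finally have "T / 2 * V - D \<le> V\<^sup>2 * measure lborel G + T * V / 8" using intQ by linarith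
      moreover have "D \<le> T * V / 4"
      proof -
        have "T * 1 \<le> T * V" using elim V by (intro mult_left_mono) auto
        thus ?thesis using elim by linarith
      qed
      ultimately have "T * V / 8 \<le> V\<^sup>2 * measure lborel G" by linarith
      hence "V * (T / 8) \<le> V * (V * measure lborel G)" by (simp add: power2_eq_square mult_ac)
      hence "T / 8 \<le> V * measure lborel G" using V by simp
      hence 1: "1 / (8 * V) \<le> 1 / T * measure lborel G" using V elim by (simp add: field_simps)
      have "measure lborel G \<le> measure lborel {t \<in> {0..T}. norm (Z t - z\<^sub>0) < \<epsilon>}"
      proof (rule measure_mono_fmeasurable)
        show "G \<subseteq> {t \<in> {0..T}. norm (Z t - z\<^sub>0) < \<epsilon>}" unfolding G_def using elim by auto
        show "G \<in> sets lborel" unfolding G_def sets_lborel by (rule meas)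
        show "{t \<in> {0..T}. norm (Z t - z\<^sub>0) < \<epsilon>} \<in> fmeasurable lborel"
        proof (rule fmeasurableI2)
          show "{0..T} \<in> fmeasurable lborel" by (rule fmeasurableI) (auto simp: emeasure_lborel_Icc_eq)
          show "{t \<in> {0..T}. norm (Z t - z\<^sub>0) < \<epsilon>} \<in> sets lborel" unfolding sets_lborel by (rule meas)
        qed auto
      qed
      also have "\<dots> = measure lebesgue {t \<in> {0..T}. norm (Z t - z\<^sub>0) < \<epsilon>}"
        by (rule measure_completion[symmetric]) (unfold sets_lborel, rule meas)
      finally have "1 / T * measure lborel G \<le> 1 / T * measure lebesgue {t \<in> {0..T}. norm (Z t - z\<^sub>0) < \<epsilon>}"
        using elim by (intro mult_left_mono) auto
      with 1 show ?case by linarith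
    qed
    have "0 < ereal (1 / (8 * V))" using V by simp
    also have "\<dots> \<le> Liminf at_top (\<lambda>T :: real. ereal (1 / T * measure lebesgue {t \<in> {0..T}. norm (Z t - z\<^sub>0) < \<epsilon>}))"
      by (rule Liminf_bounded) (use ev in \<open>simp only: ereal_less_eq\<close>)
    finally show "Liminf at_top (\<lambda>T :: real. ereal (1 / T *
         measure lebesgue {t \<in> {0..T}. norm (hurwitz_zeta (Complex \<sigma> t) \<alpha> - z\<^sub>0) < \<epsilon>})) > 0"
      by (simp only: Z_def)
  qed
qed

theorem theorem1p3:
  fixes c \<sigma> \<epsilon> :: real and d :: nat and z\<^sub>0 :: complex
  assumes "0 < c" and "c < 1"
    and "d > 0" and "\<not> is_square d"
    and "1 / 2 < \<sigma>" and "\<sigma> < 1"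
    and "\<epsilon> > 0"
  shows "\<exists>E. finite E \<and> E \<subseteq> quad_irrationals c d \<and>
    (\<forall>\<alpha> \<in> quad_irrationals c d - E.
       Liminf at_top (\<lambda>T :: real. ereal (1 / T *
         measure lebesgue {t \<in> {0..T}. norm (hurwitz_zeta (Complex \<sigma> t) \<alpha> - z\<^sub>0) < \<epsilon>})) > 0)"
proof -
  obtain E where "finite E" and E: "\<And>\<alpha>. c < \<alpha> \<Longrightarrow> \<alpha> < 1 \<Longrightarrow> \<alpha> \<notin> E \<Longrightarrow>
       Liminf at_top (\<lambda>T :: real. ereal (1 / T *
         measure lebesgue {t \<in> {0..T}. norm (hurwitz_zeta (Complex \<sigma> t) \<alpha> - z\<^sub>0) < \<epsilon>})) > 0"
    using hurwitz_value_density[OF assms(1,2,5-7), of z\<^sub>0] by auto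
  thus ?thesis
    by (intro exI[of _ "E \<inter> quad_irrationals c d"]) (auto intro!: E dest: quad_irrationals_bounds)
qed

end
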